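(* Let $\lambda>0$ be fixed. Suppose that $(x_j)_{j\in\mathbb{Z}}$ is a real sequence satisfying the following condition: there exist positive numbers $q$ and $Q$ such that $q\le x_{j+1}-x_j\le Q$ for every integer $j$. Let $A=A_\lambda$ be the bi-infinite matrix whose entries are given by $A(j,k)=e^{-\lambda(x_j-x_k)^2}$, $j,k\in\mathbb{Z}$. Given $p\in[1,\infty]$ and $\overline{y}:=(y_l)_{l\in\mathbb{Z}}\in\ell_p(\mathbb{Z})$, define $$I_\lambda(\overline{y},x):=\sum_{k\in\mathbb{Z}}(A^{-1}\overline{y})_k\,e^{-\lambda(x-x_k)^2},\qquad x\in\mathbb{R},$$ where $(A^{-1}\overline{y})_k$ denotes the $k$-th component of the sequence $A^{-1}\overline{y}$. The following hold. (i) The function $\mathbb{R}\ni x\mapsto I_\lambda(\overline{y},x)$ is continuous on $\mathbb{R}$. (ii) If $x$ is any real number, then $I_\lambda(\overline{y},x)=\sum_{l\in\mathbb{Z}}y_lL_l(x)$, where $L_l(x):=\sum_{k\in\mathbb{Z}}A^{-1}(k,l)e^{-\lambda(x-x_k)^2}$ for $l\in\mathbb{Z}$ and $x\in\mathbb{R}$. (iii) There is a constant $\beta_3$, depending on $\lambda$, $q$, $Q$, and $p$, such that $\|I_\lambda(\overline{y},\cdot)\|_{L_p(\mathbb{R})}\le\beta_3\|\overline{y}\|_{\ell_p(\mathbb{Z})}$ for every $\overline{y}\in\ell_p(\mathbb{Z})$.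
   Context: The matrix $A$ acts as a bounded, self-adjoint, boundedly invertible operator on $\ell_2(\mathbb{Z})$; $A^{-1}$ denotes its inverse on $\ell_2(\mathbb{Z})$ and $A^{-1}(k,l)$, $k,l\in\mathbb{Z}$, the entries of the matrix of $A^{-1}$. These entries decay exponentially in $|k-l|$, so the matrix $A^{-1}$ acts as a bounded operator on every $\ell_p(\mathbb{Z})$, $1\le p\le\infty$, by $(A^{-1}\overline{y})_k=\sum_{l\in\mathbb{Z}}A^{-1}(k,l)y_l$. *)

theory Defs
  imports "HOL-Analysis.Analysis" "HOL-Probability.Essential_Supremum"
begin

text \<open>
  Exponents \<open>p \<in> [1,\<infinity>]\<close> are extended reals. Scalars are complex; real data are the special
  case of complex sequences with real values.
\<close>

definition ell_space :: "ereal \<Rightarrow> (int \<Rightarrow> complex) set" where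
  "ell_space p =
     {y. if p = \<infinity> then bounded (range y)
         else (\<lambda>l. norm (y l) powr real_of_ereal p) summable_on UNIV}"

definition ell_norm :: "ereal \<Rightarrow> (int \<Rightarrow> complex) \<Rightarrow> real" where
  "ell_norm p y =
     (if p = \<infinity> then (SUP l. norm (y l))
      else (\<Sum>\<^sub>\<infinity>l. norm (y l) powr real_of_ereal p) powr (1 / real_of_ereal p))"

definition Lp_space :: "ereal \<Rightarrow> (real \<Rightarrow> complex) set" where
  "Lp_space p =
     {f \<in> borel_measurable lborel.
        if p = \<infinity> then esssup lborel (\<lambda>t. ereal (norm (f t))) < \<infinity>
        else integrable lborel (\<lambda>t. norm (f t) powr real_of_ereal p)}"

text \<open>Meaningful only for members of \<open>Lp_space p\<close>; outside, the value is a default.\<close>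

definition Lp_norm :: "ereal \<Rightarrow> (real \<Rightarrow> complex) \<Rightarrow> real" where
  "Lp_norm p f =
     (if p = \<infinity> then real_of_ereal (esssup lborel (\<lambda>t. ereal (norm (f t))))
      else (LINT t|lborel. norm (f t) powr real_of_ereal p) powr (1 / real_of_ereal p))"

definition matrix_apply :: "(int \<Rightarrow> int \<Rightarrow> complex) \<Rightarrow> (int \<Rightarrow> complex) \<Rightarrow> int \<Rightarrow> complex" where
  "matrix_apply M y = (\<lambda>k. \<Sum>\<^sub>\<infinity>l. M k l * y l)"

definition gauss :: "real \<Rightarrow> real \<Rightarrow> complex" where
  "gauss lam t = of_real (exp (- lam * t\<^sup>2))"

definition gauss_matrix :: "real \<Rightarrow> (int \<Rightarrow> real) \<Rightarrow> int \<Rightarrow> int \<Rightarrow> complex" where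
  "gauss_matrix lam x j k = gauss lam (x j - x k)"

text \<open>
  The inverse of \<open>A\<close> as an operator on \<open>\<ell>\<^sub>2(\<int>)\<close>. It is a genuine two-sided inverse because
  \<open>A\<close> is a bijection of \<open>\<ell>\<^sub>2(\<int>)\<close> for the node sequences considered.
\<close>

definition gauss_inv_op :: "real \<Rightarrow> (int \<Rightarrow> real) \<Rightarrow> (int \<Rightarrow> complex) \<Rightarrow> int \<Rightarrow> complex" where
  "gauss_inv_op lam x = inv_into (ell_space 2) (matrix_apply (gauss_matrix lam x))"

text \<open>
  The matrix of the inverse: column \<open>l\<close> is the image of the \<open>l\<close>-th unit vector. On
  \<open>\<ell>\<^sub>p\<close> the inverse acts through this matrix, not through \<open>gauss_inv_op\<close>.
\<close>

definition gauss_inv :: "real \<Rightarrow> (int \<Rightarrow> real) \<Rightarrow> int \<Rightarrow> int \<Rightarrow> complex" where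
  "gauss_inv lam x k l = gauss_inv_op lam x (\<lambda>j. if j = l then 1 else 0) k"

definition gauss_interp :: "real \<Rightarrow> (int \<Rightarrow> real) \<Rightarrow> (int \<Rightarrow> complex) \<Rightarrow> real \<Rightarrow> complex" where
  "gauss_interp lam x y t =
     (\<Sum>\<^sub>\<infinity>k. matrix_apply (gauss_inv lam x) y k * gauss lam (t - x k))"

definition gauss_fundamental :: "real \<Rightarrow> (int \<Rightarrow> real) \<Rightarrow> int \<Rightarrow> real \<Rightarrow> complex" where
  "gauss_fundamental lam x l t = (\<Sum>\<^sub>\<infinity>k. gauss_inv lam x k l * gauss lam (t - x k))"

definition quasi_uniform :: "real \<Rightarrow> real \<Rightarrow> (int \<Rightarrow> real) \<Rightarrow> bool" where
  "quasi_uniform q Q x \<longleftrightarrow> (\<forall>j. q \<le> x (j + 1) - x j \<and> x (j + 1) - x j \<le> Q)"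

end

theory Submission
  imports Defs "HOL-Probability.Characteristic_Functions"
begin

text \<open>
  The Gaussian is the Fourier transform of a Gaussian density, which dominates a multiple of a wide
  tent function; comparing quadratic forms shows that \<open>A\<close> is coercive with a constant depending only on
  \<open>\<lambda>\<close> and \<open>q\<close>. Hence \<open>v \<mapsto> v - \<tau> A v\<close> is a contraction of \<open>\<ell>\<^sub>2\<close> for suitable \<open>\<tau>\<close>, and \<open>A u = e\<^sub>l\<close>
  is solved by iterating it. Conjugating \<open>A\<close> with weights growing slowly away from \<open>l\<close> keeps it
  coercive, so \<open>u\<close> decays exponentially away from \<open>l\<close>, uniformly in the nodes. Consequently
  \<open>\<bar>L\<^sub>l(x)\<bar> \<le> K exp (- \<delta> \<bar>x - x\<^sub>l\<bar>)\<close>, and the \<open>L\<^sub>p\<close> bound follows by the Schur test.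
\<close>

subsection \<open>Convolution kernels on the integers\<close>

text \<open>A lower bound for the Gaussian form needs a minorant of the density whose transform is
  summably small away from 0. The tent qualifies because it is continuous: its transform decays
  quadratically, and widening the tent raises the diagonal while shrinking the off-diagonal sums, so
  the diagonal wins for every separation of the nodes. The constant in the final bound must not
  depend on the nodes. Hence all constants are obtained before the nodes, and they are functions of
  a dominating kernel and a coercivity number alone. A solution multiplied by an unbounded weight is
  not known beforehand to be square summable. The weights are therefore truncated, and the bound on
  the solution is arranged so as not to see the truncation. Since \<open>inv_into\<close> returns a
  preimage only for members of the range, solvability for unit vectors comes before any statement
  about the entries of the inverse. The decay estimate holds for every square summable solution,
  hence for the preimage that \<open>inv_into\<close> selects.\<close>

lemma summable_on_int:
  fixes f :: "int \<Rightarrow> real"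
  assumes "summable (\<lambda>n. f (int n))" "summable (\<lambda>n. f (- int n))" "\<And>n. 0 \<le> f n"
  shows "f summable_on UNIV"
proof -
  have "(\<lambda>n. f (int n)) summable_on UNIV" "(\<lambda>n. f (- int n)) summable_on UNIV"
    using assms by (auto intro: summable_nonneg_imp_summable_on)
  then have "f summable_on range int" "f summable_on range (\<lambda>n. - int n)"
    by (simp_all add: summable_on_reindex inj_on_def o_def)
  then have "f summable_on (range int \<union> range (\<lambda>n. - int n))"
    by (rule summable_on_union)
  also have "range int \<union> range (\<lambda>n. - int n) = UNIV"
    by (auto intro: int_cases2)
  finally show ?thesis .
qed

lemma exp_abs_summable_on_int:
  assumes "0 < r"
  shows "(\<lambda>n::int. exp (- r * \<bar>real_of_int n\<bar>)) summable_on UNIV"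
proof -
  have "summable (\<lambda>n. exp (- r) ^ n)"
    using assms by (intro summable_geometric) auto
  then have "summable (\<lambda>n::nat. exp (- r * real n))"
    by (simp add: exp_of_nat_mult[symmetric] mult.commute)
  then show ?thesis
    by (intro summable_on_int) auto
qed

text \<open>The summand vanishes at \<open>n = 0\<close>, by the convention \<open>1 / 0 = 0\<close>.\<close>

lemma inverse_square_summable_on_int:
  "(\<lambda>n::int. 1 / (real_of_int n)\<^sup>2) summable_on UNIV"
proof -
  have "summable (\<lambda>n::nat. 1 / (real n)\<^sup>2)"
    using inverse_power_summable[of 2, where ?'a = real] by (simp add: field_simps)
  then show ?thesis
    by (intro summable_on_int) auto
qed

lemma
  fixes f :: "int \<Rightarrow> real"
  assumes "f summable_on UNIV"
  shows summable_on_int_shift: "(\<lambda>k. f (k - j)) summable_on UNIV"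
    and summable_on_int_reflect: "(\<lambda>k. f (j - k)) summable_on UNIV"
    and infsum_int_shift: "(\<Sum>\<^sub>\<infinity>k. f (k - j)) = infsum f UNIV"
    and infsum_int_reflect: "(\<Sum>\<^sub>\<infinity>k. f (j - k)) = infsum f UNIV"
proof -
  show "(\<lambda>k. f (k - j)) summable_on UNIV"
    by (rule iffD2[OF summable_on_reindex_bij_witness[where i = "\<lambda>k. k + j" and j = "\<lambda>k. k - j"] assms]) auto
  show "(\<lambda>k. f (j - k)) summable_on UNIV"
    by (rule iffD2[OF summable_on_reindex_bij_witness[where i = "\<lambda>k. j - k" and j = "\<lambda>k. j - k"] assms]) auto
  show "(\<Sum>\<^sub>\<infinity>k. f (k - j)) = infsum f UNIV"
    by (rule infsum_reindex_bij_witness[where i = "\<lambda>k. k + j" and j = "\<lambda>k. k - j"]) auto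
  show "(\<Sum>\<^sub>\<infinity>k. f (j - k)) = infsum f UNIV"
    by (rule infsum_reindex_bij_witness[where i = "\<lambda>k. j - k" and j = "\<lambda>k. j - k"]) auto
qed

lemma
  fixes f :: "int \<Rightarrow> real"
  assumes "f summable_on UNIV" "\<And>n. 0 \<le> f n" "finite F"
  shows sum_int_shift_le: "(\<Sum>k\<in>F. f (k - j)) \<le> infsum f UNIV"
    and sum_int_reflect_le: "(\<Sum>k\<in>F. f (j - k)) \<le> infsum f UNIV"
  using finite_sum_le_infsum[OF summable_on_int_shift[OF assms(1), of j], of F]
    finite_sum_le_infsum[OF summable_on_int_reflect[OF assms(1), of j], of F] assms
  by (simp_all add: infsum_int_shift infsum_int_reflect)

lemma schur_sum_le:
  fixes f :: "int \<Rightarrow> real"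
  assumes "f summable_on UNIV" "\<And>n. 0 \<le> f n" "finite F" "finite G" "\<And>k. 0 \<le> a k"
  shows "(\<Sum>j\<in>G. \<Sum>k\<in>F. f (j - k) * a k) \<le> infsum f UNIV * (\<Sum>k\<in>F. a k)"
proof -
  have "(\<Sum>j\<in>G. \<Sum>k\<in>F. f (j - k) * a k) = (\<Sum>k\<in>F. (\<Sum>j\<in>G. f (j - k)) * a k)"
    by (subst sum.swap) (simp add: sum_distrib_right)
  also have "\<dots> \<le> (\<Sum>k\<in>F. infsum f UNIV * a k)"
    using assms by (intro sum_mono mult_right_mono sum_int_shift_le)
  finally show ?thesis
    by (simp add: sum_distrib_left)
qed

text \<open>The arithmetic-geometric mean inequality for
  \<open>\<bar>v j\<bar> * \<bar>v k\<bar>\<close> leaves row sums and column sums of the kernel,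
  each at most its total mass.\<close>

lemma schur_bilinear:
  fixes f :: "int \<Rightarrow> real" and v :: "int \<Rightarrow> real"
  assumes f: "f summable_on UNIV" "\<And>n. 0 \<le> f n" and "finite F"
  shows "(\<Sum>j\<in>F. \<Sum>k\<in>F. f (j - k) * (\<bar>v j\<bar> * \<bar>v k\<bar>)) \<le> infsum f UNIV * (\<Sum>k\<in>F. (v k)\<^sup>2)"
proof -
  have "(\<Sum>j\<in>F. \<Sum>k\<in>F. f (j - k) * (\<bar>v j\<bar> * \<bar>v k\<bar>))
      \<le> (\<Sum>j\<in>F. \<Sum>k\<in>F. f (j - k) * (((v j)\<^sup>2 + (v k)\<^sup>2) / 2))"
  proof (intro sum_mono mult_left_mono f)
    fix j k
    have "0 \<le> (\<bar>v j\<bar> - \<bar>v k\<bar>)\<^sup>2" by simp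
    then show "\<bar>v j\<bar> * \<bar>v k\<bar> \<le> ((v j)\<^sup>2 + (v k)\<^sup>2) / 2"
      by (simp add: power2_diff)
  qed
  also have "\<dots> = (\<Sum>j\<in>F. (\<Sum>k\<in>F. f (j - k)) * (v j)\<^sup>2) / 2
      + (\<Sum>j\<in>F. \<Sum>k\<in>F. f (j - k) * (v k)\<^sup>2) / 2"
    by (simp add: sum_distrib_right sum_divide_distrib flip: sum.distrib)
      (simp add: field_simps)
  also have "\<dots> \<le> (\<Sum>j\<in>F. infsum f UNIV * (v j)\<^sup>2) / 2 + (infsum f UNIV * (\<Sum>k\<in>F. (v k)\<^sup>2)) / 2"
    using assms by (intro add_mono divide_right_mono sum_mono mult_right_mono sum_int_reflect_le schur_sum_le) auto
  finally show ?thesis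
    by (simp add: sum_distrib_left)
qed

text \<open>Schur's test on finite sections. Cauchy-Schwarz with the kernel split into two square
  roots spends one total mass on the row sum; exchanging the sums spends the second.
  \<open>F\<close> and \<open>G\<close> are separate because the image of a vector supported in
  \<open>F\<close> spreads beyond \<open>F\<close>.\<close>

lemma schur_operator:
  fixes f :: "int \<Rightarrow> real" and v :: "int \<Rightarrow> real"
  assumes f: "f summable_on UNIV" "\<And>n. 0 \<le> f n" and "finite F" "finite G"
  shows "(\<Sum>j\<in>G. (\<Sum>k\<in>F. f (j - k) * \<bar>v k\<bar>)\<^sup>2) \<le> (infsum f UNIV)\<^sup>2 * (\<Sum>k\<in>F. (v k)\<^sup>2)"
proof -
  let ?S = "infsum f UNIV"
  have S: "0 \<le> ?S" using f by (intro infsum_nonneg) auto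
  have "(\<Sum>k\<in>F. f (j - k) * \<bar>v k\<bar>)\<^sup>2 \<le> ?S * (\<Sum>k\<in>F. f (j - k) * (v k)\<^sup>2)" for j
  proof -
    have "(\<Sum>k\<in>F. f (j - k) * \<bar>v k\<bar>)\<^sup>2 = (\<Sum>k\<in>F. sqrt (f (j - k)) * (sqrt (f (j - k)) * \<bar>v k\<bar>))\<^sup>2"
      using f(2) by (simp flip: mult.assoc)
    also have "\<dots> \<le> (\<Sum>k\<in>F. (sqrt (f (j - k)))\<^sup>2) * (\<Sum>k\<in>F. (sqrt (f (j - k)) * \<bar>v k\<bar>)\<^sup>2)"
      by (rule Cauchy_Schwarz_ineq_sum)
    also have "\<dots> = (\<Sum>k\<in>F. f (j - k)) * (\<Sum>k\<in>F. f (j - k) * (v k)\<^sup>2)"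
      using f(2) by (simp add: power_mult_distrib)
    also have "\<dots> \<le> ?S * (\<Sum>k\<in>F. f (j - k) * (v k)\<^sup>2)"
      using assms by (intro mult_right_mono sum_int_reflect_le sum_nonneg) auto
    finally show ?thesis .
  qed
  then have "(\<Sum>j\<in>G. (\<Sum>k\<in>F. f (j - k) * \<bar>v k\<bar>)\<^sup>2) \<le> ?S * (\<Sum>j\<in>G. \<Sum>k\<in>F. f (j - k) * (v k)\<^sup>2)"
    by (simp add: sum_distrib_left sum_mono)
  also have "\<dots> \<le> ?S * (?S * (\<Sum>k\<in>F. (v k)\<^sup>2))"
    using assms S by (intro mult_left_mono schur_sum_le) auto
  finally show ?thesis
    by (simp add: power2_eq_square mult.assoc)
qed

subsection \<open>Coercivity of Gaussian matrices\<close>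

text \<open>Real part of the characteristic function of the normal distribution. It exhibits the
  Gaussian as a superposition of cosines with positive weights, the form in which quadratic forms
  can be compared.\<close>

lemma
  shows integrable_std_normal_cos: "integrable lborel (\<lambda>x. std_normal_density x * cos (t * x))"
    and exp_square_eq_integral_cos:
      "(LINT x|lborel. std_normal_density x * cos (t * x)) = exp (- t\<^sup>2 / 2)"
proof -
  interpret N: real_distribution std_normal_distribution
    by (rule real_dist_normal_dist)
  have int: "integrable std_normal_distribution (\<lambda>x. iexp (t * x))"
    by (rule N.integrable_iexp) auto
  have "char std_normal_distribution t = exp (- t\<^sup>2 / 2)"
    by (simp add: char_std_normal_distribution exp_of_real)
  then have "Re (CLINT x|std_normal_distribution. iexp (t * x)) = exp (- t\<^sup>2 / 2)"
    by (simp add: char_def)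
  then have eq: "(LINT x|std_normal_distribution. cos (t * x)) = exp (- t\<^sup>2 / 2)"
    by (subst (asm) integral_Re[symmetric, OF int]) (simp add: Re_exp)
  have "integrable std_normal_distribution (\<lambda>x. cos (t * x))"
    using integrable_Re[OF int] by (simp add: Re_exp)
  then show "integrable lborel (\<lambda>x. std_normal_density x * cos (t * x))"
    by (subst (asm) integrable_density) (auto simp: normal_density_nonneg)
  show "(LINT x|lborel. std_normal_density x * cos (t * x)) = exp (- t\<^sup>2 / 2)"
    using eq by (subst (asm) integral_density) (auto simp: normal_density_nonneg)
qed

text \<open>Half of the Fourier transform of the tent \<open>max 0 (1 - \<bar>x\<bar> / R)\<close>;
  the tent is even, so integrating over \<open>{0..R}\<close> is enough. For
  \<open>s \<noteq> 0\<close> it is the Fejer-type kernel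
  \<open>(1 - cos (s * R)) / (R * s^2)\<close>.\<close>

definition tent_cos :: "real \<Rightarrow> real \<Rightarrow> real" where
  "tent_cos R s = (LINT x|lborel. ((1 - x / R) * cos (s * x)) * indicator {0..R} x)"

lemma integrable_tent_cos:
  fixes R s :: real
  shows "integrable lborel (\<lambda>x. ((1 - x / R) * cos (s * x)) * indicator {0..R} x)"
proof -
  have "integrable lborel (\<lambda>x. indicator {0..R} x *\<^sub>R ((1 - x / R) * cos (s * x)))"
    unfolding divide_inverse by (intro borel_integrable_compact compact_Icc continuous_intros)
  then show ?thesis by (simp add: mult.commute)
qed

lemma tent_cos_0:
  assumes "0 < R"
  shows "tent_cos R 0 = R / 2"
proof -
  have "tent_cos R 0 = (R - R\<^sup>2 / (2 * R)) - (0 - 0\<^sup>2 / (2 * R))"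
    unfolding tent_cos_def mult_zero_left cos_zero mult_1_right
    using assms by (intro integral_FTC_Icc_real) (auto intro!: derivative_eq_intros continuous_intros simp: field_simps power2_eq_square)
  then show ?thesis using assms by (simp add: power2_eq_square)
qed

text \<open>Integration by parts, with \<open>?F\<close> as the resulting antiderivative. The tent
  vanishes at \<open>R\<close>, so the sine term drops out at both ends and quadratic decay in
  \<open>s\<close> remains.\<close>

lemma abs_tent_cos_le:
  assumes "0 < R" "s \<noteq> 0"
  shows "\<bar>tent_cos R s\<bar> \<le> 2 / (R * s\<^sup>2)"
proof -
  let ?F = "\<lambda>x. (1 - x / R) * sin (s * x) / s - cos (s * x) / (R * s\<^sup>2)"
  have "tent_cos R s = ?F R - ?F 0"
    unfolding tent_cos_def using assms
    by (intro integral_FTC_Icc_real)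
      (auto intro!: derivative_eq_intros continuous_intros simp: field_simps power2_eq_square)
  also have "\<dots> = (1 - cos (s * R)) / (R * s\<^sup>2)"
    using assms by (simp add: diff_divide_distrib)
  finally have "\<bar>tent_cos R s\<bar> = (1 - cos (s * R)) / (R * s\<^sup>2)"
    using assms by simp
  also have "\<dots> \<le> 2 / (R * s\<^sup>2)"
    using assms cos_ge_minus_one[of "s * R"] by (intro divide_right_mono) auto
  finally show ?thesis .
qed

text \<open>The form is the squared modulus of the exponential sum with coefficients
  \<open>v j\<close> and frequencies \<open>z j\<close>, written as real part squared plus imaginary
  part squared.\<close>

lemma quad_cos_nonneg:
  "0 \<le> (\<Sum>j\<in>F. \<Sum>k\<in>F. v j * v k * cos ((z j - z k) * x :: real))"
proof -
  have "(\<Sum>j\<in>F. \<Sum>k\<in>F. v j * v k * cos ((z j - z k) * x))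
      = (\<Sum>j\<in>F. v j * cos (z j * x))\<^sup>2 + (\<Sum>j\<in>F. v j * sin (z j * x))\<^sup>2"
    by (simp add: power2_eq_square sum_product left_diff_distrib cos_diff
        flip: sum.distrib) (simp add: algebra_simps)
  then show ?thesis by simp
qed

text \<open>Both sides are integrals of the same nonnegative form \<open>?P x\<close> against a
  weight in \<open>x\<close>, so the weights may be compared pointwise. The tent of height
  \<open>std_normal_density R\<close> lies below the density because the density decreases on the
  positive half-line.\<close>

lemma gaussian_quad_ge_tent:
  assumes "0 < R"
  shows "std_normal_density R * (\<Sum>j\<in>F. \<Sum>k\<in>F. v j * v k * tent_cos R (z j - z k))
    \<le> (\<Sum>j\<in>F. \<Sum>k\<in>F. v j * v k * exp (- (z j - z k)\<^sup>2 / 2))"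
proof -
  let ?P = "\<lambda>x. \<Sum>j\<in>F. \<Sum>k\<in>F. v j * v k * cos ((z j - z k) * x)"
  let ?g = "\<lambda>x. std_normal_density R * (\<Sum>j\<in>F. \<Sum>k\<in>F. v j * v k * (((1 - x / R) * cos ((z j - z k) * x)) * indicator {0..R} x))"
  let ?f = "\<lambda>x. \<Sum>j\<in>F. \<Sum>k\<in>F. v j * v k * (std_normal_density x * cos ((z j - z k) * x))"
  have "integral\<^sup>L lborel ?g \<le> integral\<^sup>L lborel ?f"
  proof (rule integral_mono)
    show "integrable lborel ?g"
      by (intro integrable_mult_right Bochner_Integration.integrable_sum integrable_tent_cos)
    show "integrable lborel ?f"
      by (intro integrable_mult_right Bochner_Integration.integrable_sum integrable_std_normal_cos)
    fix x
    have f: "?f x = std_normal_density x * ?P x"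
      by (simp add: sum_distrib_left mult_ac)
    have g: "?g x = (std_normal_density R * ((1 - x / R) * indicator {0..R} x)) * ?P x"
      by (simp add: sum_distrib_left mult_ac)
    have "std_normal_density R * ((1 - x / R) * indicator {0..R} x) \<le> std_normal_density x"
    proof (cases "x \<in> {0..R}")
      case True
      have "std_normal_density R * (1 - x / R) \<le> std_normal_density R"
        using True assms by (intro mult_left_le) (auto simp: normal_density_nonneg)
      also have "\<dots> \<le> std_normal_density x"
        using True by (auto simp: std_normal_density_def intro!: divide_right_mono power_mono)
      finally show ?thesis using True by simp
    qed (simp add: normal_density_nonneg)
    then show "?g x \<le> ?f x"
      unfolding f g by (intro mult_right_mono quad_cos_nonneg)
  qed
  also have "integral\<^sup>L lborel ?g = std_normal_density R * (\<Sum>j\<in>F. \<Sum>k\<in>F. v j * v k * tent_cos R (z j - z k))"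
    by (simp add: tent_cos_def integrable_tent_cos)
  also have "integral\<^sup>L lborel ?f = (\<Sum>j\<in>F. \<Sum>k\<in>F. v j * v k * exp (- (z j - z k)\<^sup>2 / 2))"
    by (simp add: exp_square_eq_integral_cos integrable_std_normal_cos)
  finally show ?thesis .
qed

text \<open>Diagonal dominance for the tent form: the diagonal entries are \<open>R / 2\<close>,
  while by separation the off-diagonal part has norm at most
  \<open>2 * S / (R * \<delta>^2)\<close>. A large \<open>R\<close> makes the latter at most half of
  the former.\<close>

lemma gaussian_quad_ge:
  assumes "0 < \<delta>"
  obtains \<theta> where "0 < \<theta>"
    "\<And>(z :: int \<Rightarrow> real) F v. \<lbrakk>\<And>j k. \<delta> * \<bar>real_of_int (j - k)\<bar> \<le> \<bar>z j - z k\<bar>; finite F\<rbrakk> \<Longrightarrow>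
      \<theta> * (\<Sum>j\<in>F. (v j)\<^sup>2) \<le> (\<Sum>j\<in>F. \<Sum>k\<in>F. v j * v k * exp (- (z j - z k)\<^sup>2 / 2))"
proof -
  let ?h = "\<lambda>n::int. 1 / (real_of_int n)\<^sup>2"
  define S where "S = infsum ?h UNIV"
  have S0: "0 \<le> S" unfolding S_def by (intro infsum_nonneg) auto
  \<comment> \<open>Chosen so that \<open>8 * S \<le> R^2 * \<delta>^2\<close>, which says that the
    off-diagonal bound is at most \<open>R / 4\<close>. The summand 1 keeps \<open>R\<close>
    positive knowing only \<open>0 \<le> S\<close>.\<close>
  define R where "R = sqrt (8 * S + 1) / \<delta>"
  have R: "0 < R" using assms S0 by (auto simp: R_def)
  have "R\<^sup>2 * \<delta>\<^sup>2 = 8 * S + 1" using assms S0 by (simp add: R_def power_divide)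
  then have RS: "2 / (R * \<delta>\<^sup>2) * S \<le> R / 4"
    using R assms by (simp add: field_simps power2_eq_square)
  show ?thesis
  proof (rule that[of "std_normal_density R * (R / 4)"])
    show "0 < std_normal_density R * (R / 4)"
      using R by (simp add: normal_density_pos)
    fix z :: "int \<Rightarrow> real" and F :: "int set" and v :: "int \<Rightarrow> real"
    assume sep: "\<And>j k. \<delta> * \<bar>real_of_int (j - k)\<bar> \<le> \<bar>z j - z k\<bar>" and F: "finite F"
    have neg_bound: "\<bar>X\<bar> \<le> Y \<Longrightarrow> - Y + 0 \<le> X" for X Y :: real
      by linarith
    \<comment> \<open>Since \<open>?h 0 = 0\<close>, a single expression covers both cases: the
      kernel term vanishes on the diagonal and the conditional vanishes off it. Thus the Schur bound
      can be applied to the full double sum.\<close>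
    have off: "- (2 / (R * \<delta>\<^sup>2) * (?h (j - k) * (\<bar>v j\<bar> * \<bar>v k\<bar>))) + (if k = j then R / 2 * (v j)\<^sup>2 else 0)
        \<le> v j * v k * tent_cos R (z j - z k)" for j k
    proof (cases "k = j")
      case True
      then show ?thesis by (simp add: tent_cos_0[OF R] power2_eq_square)
    next
      case False
      then have pos: "0 < \<delta> * \<bar>real_of_int (j - k)\<bar>" using assms by simp
      have "\<bar>tent_cos R (z j - z k)\<bar> \<le> 2 / (R * (z j - z k)\<^sup>2)"
        using pos sep[of j k] by (intro abs_tent_cos_le R) auto
      also have "\<dots> \<le> 2 / (R * (\<delta> * \<bar>real_of_int (j - k)\<bar>)\<^sup>2)"
      proof -
        have "(\<delta> * \<bar>real_of_int (j - k)\<bar>)\<^sup>2 \<le> \<bar>z j - z k\<bar>\<^sup>2"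
          using pos sep[of j k] by (intro power_mono) auto
        then show ?thesis using R pos by (intro divide_left_mono mult_left_mono) (auto intro!: mult_pos_pos)
      qed
      also have "\<dots> = 2 / (R * \<delta>\<^sup>2) * ?h (j - k)"
        by (simp add: power_mult_distrib)
      finally have "\<bar>v j * v k * tent_cos R (z j - z k)\<bar> \<le> (\<bar>v j\<bar> * \<bar>v k\<bar>) * (2 / (R * \<delta>\<^sup>2) * ?h (j - k))"
        by (simp only: abs_mult) (intro mult_left_mono, auto)
      also have "\<dots> = 2 / (R * \<delta>\<^sup>2) * (?h (j - k) * (\<bar>v j\<bar> * \<bar>v k\<bar>))"
        by (simp only: mult_ac)
      finally show ?thesis unfolding if_not_P[OF False] by (rule neg_bound)
    qed
    have "R / 4 * (\<Sum>j\<in>F. (v j)\<^sup>2) \<le> R / 2 * (\<Sum>j\<in>F. (v j)\<^sup>2) - 2 / (R * \<delta>\<^sup>2) * S * (\<Sum>j\<in>F. (v j)\<^sup>2)"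
      using mult_right_mono[OF RS, of "\<Sum>j\<in>F. (v j)\<^sup>2"] by (simp add: sum_nonneg field_simps)
    also have "\<dots> \<le> R / 2 * (\<Sum>j\<in>F. (v j)\<^sup>2)
        - 2 / (R * \<delta>\<^sup>2) * (\<Sum>j\<in>F. \<Sum>k\<in>F. ?h (j - k) * (\<bar>v j\<bar> * \<bar>v k\<bar>))"
      unfolding mult.assoc S_def using R F schur_bilinear[OF inverse_square_summable_on_int _ F, of v]
      by (intro diff_mono mult_left_mono order_refl) auto
    also have "\<dots> = (\<Sum>j\<in>F. \<Sum>k\<in>F. - (2 / (R * \<delta>\<^sup>2) * (?h (j - k) * (\<bar>v j\<bar> * \<bar>v k\<bar>)))
        + (if k = j then R / 2 * (v j)\<^sup>2 else 0))"
      using F by (simp only: sum.distrib sum_distrib_left sum_negf sum.delta) simp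
    also have "\<dots> \<le> (\<Sum>j\<in>F. \<Sum>k\<in>F. v j * v k * tent_cos R (z j - z k))"
      by (intro sum_mono off)
    finally have "std_normal_density R * (R / 4 * (\<Sum>j\<in>F. (v j)\<^sup>2))
        \<le> std_normal_density R * (\<Sum>j\<in>F. \<Sum>k\<in>F. v j * v k * tent_cos R (z j - z k))"
      by (intro mult_left_mono) (auto simp: normal_density_nonneg)
    also note gaussian_quad_ge_tent[OF R]
    finally show "std_normal_density R * (R / 4) * (\<Sum>j\<in>F. (v j)\<^sup>2)
        \<le> (\<Sum>j\<in>F. \<Sum>k\<in>F. v j * v k * exp (- (z j - z k)\<^sup>2 / 2))"
      by (simp only: mult.assoc)
  qed
qed

subsection \<open>Inverting coercive matrices\<close>

lemma abs_le_L2_set: "finite G \<Longrightarrow> k \<in> G \<Longrightarrow> \<bar>v k\<bar> \<le> L2_set v G"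
  using member_le_L2_set[of G k "\<lambda>k. \<bar>v k\<bar>"] by (simp add: L2_set_def)

text \<open>Designed for the Gaussian matrix conjugated by weights, which is no longer symmetric.
  Domination by a convolution kernel gives boundedness with constant \<open>S\<close>; coercivity is
  stated on finite sections, where the quadratic form is a finite sum.\<close>

locale coercive_matrix =
  fixes M :: "int \<Rightarrow> int \<Rightarrow> real" and f :: "int \<Rightarrow> real" and \<theta> :: real
  assumes kernel_summable: "f summable_on UNIV"
    and entry_le: "\<bar>M j k\<bar> \<le> f (j - k)"
    and theta_pos: "0 < \<theta>"
    and coercive: "finite F \<Longrightarrow> \<theta> * (\<Sum>j\<in>F. (v j)\<^sup>2) \<le> (\<Sum>j\<in>F. \<Sum>k\<in>F. v j * v k * M j k)"
begin

abbreviation "S \<equiv> infsum f UNIV"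
text \<open>One step \<open>v - \<tau> * app v\<close> has squared norm at most
  \<open>1 - 2 * \<tau> * \<theta> + \<tau>^2 * S^2\<close> times that of \<open>v\<close>. This
  \<open>\<tau>\<close> is the minimiser, and \<open>\<rho>^2\<close> is the minimum. Both depend on
  \<open>f\<close> and \<open>\<theta>\<close> only, which makes later bounds uniform over all
  matrices with these data.\<close>

definition "\<tau> = \<theta> / S\<^sup>2"
definition "\<rho> = sqrt (1 - \<theta>\<^sup>2 / S\<^sup>2)"
abbreviation "app v j \<equiv> \<Sum>\<^sub>\<infinity>k. M j k * v k"

lemma kernel_nonneg: "0 \<le> f n"
  using entry_le[of n 0] by simp

text \<open>Coercivity tested on the unit vector at 0. It makes the radicand in
  \<open>\<rho>\<close> nonnegative.\<close>

lemma theta_le: "\<theta> \<le> S"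
proof -
  have "\<theta> \<le> M 0 0" using coercive[of "{0}" "\<lambda>_. 1"] by simp
  also have "\<dots> \<le> f 0" using entry_le[of 0 0] by simp
  also have "\<dots> \<le> S"
    using finite_sum_le_infsum[OF kernel_summable, of "{0}"] kernel_nonneg by simp
  finally show ?thesis .
qed

lemma S_pos: "0 < S"
  using theta_pos theta_le by linarith

lemma rho_nonneg: "0 \<le> \<rho>" and rho_less_1: "\<rho> < 1"
proof -
  have "\<theta>\<^sup>2 \<le> S\<^sup>2" using theta_pos theta_le by (intro power_mono) auto
  then show "0 \<le> \<rho>" using S_pos by (simp add: \<rho>_def)
  show "\<rho> < 1" using S_pos theta_pos by (simp add: \<rho>_def)
qed

lemma rho_square: "\<rho>\<^sup>2 = 1 - \<theta>\<^sup>2 / S\<^sup>2"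
proof -
  have "\<theta>\<^sup>2 \<le> S\<^sup>2" using theta_pos theta_le by (intro power_mono) auto
  then show ?thesis using S_pos by (simp add: \<rho>_def)
qed

lemma tau_pos: "0 < \<tau>"
  using theta_pos S_pos by (simp add: \<tau>_def)

lemma
  assumes "\<And>k. \<bar>v k\<bar> \<le> B"
  shows summable_app: "(\<lambda>k. M j k * v k) summable_on UNIV"
    and abs_app_le: "\<bar>app v j\<bar> \<le> S * B"
proof -
  have B: "0 \<le> B" using assms[of 0] by simp
  have le: "norm (M j k * v k) \<le> f (j - k) * B" for k
    unfolding real_norm_def abs_mult
    using assms entry_le kernel_nonneg by (intro mult_mono) auto
  have sum: "((\<lambda>k. f (j - k) * B) has_sum S * B) UNIV"
    using has_sum_infsum[OF summable_on_int_reflect[OF kernel_summable, of j]]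
    unfolding infsum_int_reflect[OF kernel_summable] by (rule has_sum_cmult_left)
  show "(\<lambda>k. M j k * v k) summable_on UNIV"
    by (rule abs_summable_summable[OF Infinite_Sum.abs_summable_on_comparison_test'[OF has_sum_imp_summable[OF sum]]])
      (use le in simp)
  then show "\<bar>app v j\<bar> \<le> S * B"
    unfolding real_norm_def[symmetric] by (rule norm_infsum_le[OF has_sum_infsum sum le])
qed

text \<open>Expanding the square, coercivity bounds the cross term from below and Schur's test
  bounds the quadratic term from above.\<close>

lemma contraction_finite:
  assumes F: "finite F" "F \<subseteq> G" and G: "finite G"
  shows "(\<Sum>j\<in>G. ((if j \<in> F then v j else 0) - \<tau> * (\<Sum>k\<in>F. M j k * v k))\<^sup>2)
    \<le> \<rho>\<^sup>2 * (\<Sum>k\<in>F. (v k)\<^sup>2)"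
proof -
  define V where "V = (\<Sum>k\<in>F. (v k)\<^sup>2)"
  define c where "c j = (\<Sum>k\<in>F. M j k * v k)" for j
  let ?a = "\<lambda>j. if j \<in> F then v j else 0"
  have V: "0 \<le> V" unfolding V_def by (intro sum_nonneg) auto
  have aa: "(\<Sum>j\<in>G. (?a j)\<^sup>2) = V" unfolding V_def
    using F G by (intro sum.mono_neutral_cong_right) auto
  have "(\<Sum>j\<in>G. ?a j * c j) = (\<Sum>j\<in>F. v j * c j)"
    using F G by (intro sum.mono_neutral_cong_right) auto
  also have "\<dots> = (\<Sum>j\<in>F. \<Sum>k\<in>F. v j * v k * M j k)"
    by (simp add: c_def sum_distrib_left mult_ac)
  also have "\<dots> \<ge> \<theta> * V" unfolding V_def by (rule coercive[OF F(1)])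
  finally have ac: "\<theta> * V \<le> (\<Sum>j\<in>G. ?a j * c j)" .
  have "(\<Sum>j\<in>G. (c j)\<^sup>2) \<le> (\<Sum>j\<in>G. (\<Sum>k\<in>F. f (j - k) * \<bar>v k\<bar>)\<^sup>2)"
  proof (intro sum_mono)
    fix j
    have "\<bar>c j\<bar> \<le> (\<Sum>k\<in>F. \<bar>M j k * v k\<bar>)" unfolding c_def by (rule sum_abs)
    also have "\<dots> \<le> (\<Sum>k\<in>F. f (j - k) * \<bar>v k\<bar>)"
      unfolding abs_mult by (intro sum_mono mult_right_mono entry_le) auto
    finally show "(c j)\<^sup>2 \<le> (\<Sum>k\<in>F. f (j - k) * \<bar>v k\<bar>)\<^sup>2"
      by (rule abs_le_square_iff[THEN iffD1, OF order_trans]) simp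
  qed
  also have "\<dots> \<le> S\<^sup>2 * V"
    unfolding V_def by (rule schur_operator[OF kernel_summable kernel_nonneg F(1) G])
  finally have cc: "(\<Sum>j\<in>G. (c j)\<^sup>2) \<le> S\<^sup>2 * V" .
  have "(\<Sum>j\<in>G. (?a j - \<tau> * c j)\<^sup>2) = (\<Sum>j\<in>G. (?a j)\<^sup>2 - 2 * \<tau> * (?a j * c j) + \<tau>\<^sup>2 * (c j)\<^sup>2)"
    by (intro sum.cong refl) (simp only: power2_diff power_mult_distrib mult_ac)
  also have "\<dots> = V - 2 * \<tau> * (\<Sum>j\<in>G. ?a j * c j) + \<tau>\<^sup>2 * (\<Sum>j\<in>G. (c j)\<^sup>2)"
    unfolding sum.distrib sum_subtractf aa by (simp only: sum_distrib_left)
  also have "\<dots> \<le> V - 2 * \<tau> * (\<theta> * V) + \<tau>\<^sup>2 * (S\<^sup>2 * V)"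
    using ac cc tau_pos by (intro add_mono diff_mono mult_left_mono) auto
  also have "\<dots> = \<rho>\<^sup>2 * V"
    unfolding rho_square \<tau>_def using S_pos by (simp add: field_simps power2_eq_square)
  finally show ?thesis unfolding c_def V_def .
qed

text \<open>An \<open>\<ell>\<^sub>2\<close> norm bound is expressed as a common bound of
  \<open>L2_set\<close> over all finite sets. For fixed \<open>G\<close> the estimate for
  truncations of \<open>v\<close> passes to the limit, since only finitely many rows are
  involved.\<close>

lemma contraction:
  assumes v: "\<And>G. finite G \<Longrightarrow> L2_set v G \<le> B" and G: "finite G"
  shows "L2_set (\<lambda>j. v j - \<tau> * app v j) G \<le> \<rho> * B"
proof -
  have B: "0 \<le> B" using v[of "{}"] by simp
  have vB: "\<bar>v k\<bar> \<le> B" for k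
    using abs_le_L2_set[of "{k}" k v] v[of "{k}"] by simp
  have "(\<Sum>j\<in>G. (v j - \<tau> * app v j)\<^sup>2) \<le> (\<rho> * B)\<^sup>2"
  proof (rule tendsto_upperbound)
    show "((\<lambda>F. \<Sum>j\<in>G. (v j - \<tau> * (\<Sum>k\<in>F. M j k * v k))\<^sup>2) \<longlongrightarrow> (\<Sum>j\<in>G. (v j - \<tau> * app v j)\<^sup>2))
        (finite_subsets_at_top UNIV)"
      using infsum_tendsto[OF summable_app[OF vB]] by (intro tendsto_intros)
    show "\<forall>\<^sub>F F in finite_subsets_at_top UNIV. (\<Sum>j\<in>G. (v j - \<tau> * (\<Sum>k\<in>F. M j k * v k))\<^sup>2) \<le> (\<rho> * B)\<^sup>2"
      unfolding eventually_finite_subsets_at_top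
    proof (intro exI[of _ G] conjI allI impI G subset_UNIV, elim conjE)
      fix F assume F: "finite F" "G \<subseteq> F"
      \<comment> \<open>Enlarging the outer sum from \<open>G\<close> to \<open>F\<close> turns
        \<open>v\<close> into its own truncation, as required by the finite estimate.\<close>
      have "(\<Sum>j\<in>G. (v j - \<tau> * (\<Sum>k\<in>F. M j k * v k))\<^sup>2)
          \<le> (\<Sum>j\<in>F. ((if j \<in> F then v j else 0) - \<tau> * (\<Sum>k\<in>F. M j k * v k))\<^sup>2)"
        using F by (simp add: sum_mono2)
      also have "\<dots> \<le> \<rho>\<^sup>2 * (\<Sum>k\<in>F. (v k)\<^sup>2)"
        using F by (intro contraction_finite) auto
      also have "(\<Sum>k\<in>F. (v k)\<^sup>2) \<le> B\<^sup>2"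
        using v[OF F(1)] B by (simp add: L2_set_def real_sqrt_le_iff' sum_nonneg)
      finally show "(\<Sum>j\<in>G. (v j - \<tau> * (\<Sum>k\<in>F. M j k * v k))\<^sup>2) \<le> (\<rho> * B)\<^sup>2"
        by (simp add: power_mult_distrib mult_left_mono)
    qed
  qed simp
  then show ?thesis
    using B rho_nonneg unfolding L2_set_def by (intro real_le_lsqrt) auto
qed

text \<open>Writing \<open>v\<close> as \<open>(v - \<tau> * app v) + \<tau> * app v\<close> gives
  \<open>C \<le> \<rho> * C + \<tau> * \<beta>\<close> for the norm \<open>C\<close> of
  \<open>v\<close>. The bound \<open>B\<close> certifies that \<open>C\<close> is finite, so that
  \<open>\<rho> * C\<close> can be absorbed; the result is free of \<open>B\<close>, which will grow
  with the truncation level of the weights.\<close>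

lemma solution_bound:
  assumes v: "\<And>G. finite G \<Longrightarrow> L2_set v G \<le> B"
    and b: "\<And>G. finite G \<Longrightarrow> L2_set (app v) G \<le> \<beta>"
    and G: "finite G"
  shows "L2_set v G \<le> \<tau> * \<beta> / (1 - \<rho>)"
proof -
  define C where "C = (SUP G\<in>{G. finite G}. L2_set v G)"
  have bdd: "bdd_above (L2_set v ` {G. finite G})"
    using v by (intro bdd_aboveI2) auto
  have C: "L2_set v G \<le> C" if "finite G" for G
    unfolding C_def using that bdd by (intro cSUP_upper) auto
  have "C \<le> \<rho> * C + \<tau> * \<beta>"
    unfolding C_def[symmetric]
  proof (subst C_def, intro cSUP_least)
    fix G :: "int set" assume "G \<in> {G. finite G}"
    then have G: "finite G" by simp
    have "L2_set v G = L2_set (\<lambda>j. (v j - \<tau> * app v j) + \<tau> * app v j) G" by simp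
    also have "\<dots> \<le> L2_set (\<lambda>j. v j - \<tau> * app v j) G + L2_set (\<lambda>j. \<tau> * app v j) G"
      by (rule L2_set_triangle_ineq)
    also have "L2_set (\<lambda>j. \<tau> * app v j) G = \<tau> * L2_set (app v) G"
      using tau_pos by (intro L2_set_right_distrib[symmetric]) simp
    also have "L2_set (\<lambda>j. v j - \<tau> * app v j) G + \<tau> * L2_set (app v) G \<le> \<rho> * C + \<tau> * \<beta>"
      using tau_pos by (intro add_mono mult_left_mono contraction C b G) auto
    finally show "L2_set v G \<le> \<rho> * C + \<tau> * \<beta>" .
  qed auto
  then have "C * (1 - \<rho>) \<le> \<tau> * \<beta>" by (simp add: algebra_simps)
  then have "C \<le> \<tau> * \<beta> / (1 - \<rho>)"
    using rho_less_1 by (subst pos_le_divide_eq) auto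
  then show ?thesis using C[OF G] by linarith
qed

text \<open>The powers of \<open>1 - \<tau> M\<close> applied to \<open>e\<close>, that is, the
  residuals of Richardson iteration started at zero.\<close>

primrec residual :: "(int \<Rightarrow> real) \<Rightarrow> nat \<Rightarrow> int \<Rightarrow> real" where
  "residual e 0 = e"
| "residual e (Suc n) = (\<lambda>j. residual e n j - \<tau> * app (residual e n) j)"

text \<open>The solution is the Neumann series \<open>\<tau>\<close> times the sum of all residuals;
  the residuals decay like \<open>\<rho> ^ n\<close> by contraction.\<close>

lemma solution_exists:
  assumes e: "\<And>G. finite G \<Longrightarrow> L2_set e G \<le> 1"
  shows "\<exists>u B. (\<forall>G. finite G \<longrightarrow> L2_set u G \<le> B) \<and> (\<forall>j. app u j = e j)"
proof -
  let ?r = "residual e"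
  have r: "L2_set (?r n) G \<le> \<rho> ^ n" if "finite G" for n G
    using that
  proof (induction n arbitrary: G)
    case (Suc n)
    then show ?case
      unfolding residual.simps power_Suc by (intro contraction)
  qed (simp add: e)
  have r_le: "\<bar>?r n k\<bar> \<le> \<rho> ^ n" for n k
    using abs_le_L2_set[of "{k}" k "?r n"] r[of "{k}" n] by simp
  have geom: "summable (\<lambda>n. \<tau> * \<rho> ^ n)"
    using rho_nonneg rho_less_1 by (intro summable_mult summable_geometric) simp
  have summ: "summable (\<lambda>n. \<tau> * ?r n k)" for k
    by (rule summable_comparison_test'[OF geom, of 0])
      (use r_le[of _ k] tau_pos in \<open>simp add: abs_mult mult_left_mono\<close>)
  define w where "w N k = (\<Sum>n<N. \<tau> * ?r n k)" for N k
  have w_Suc: "w (Suc N) = (\<lambda>k. w N k + \<tau> * ?r N k)" for N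
    by (simp add: w_def fun_eq_iff)
  define u where "u k = (\<Sum>n. \<tau> * ?r n k)" for k
  have w_tendsto: "(\<lambda>N. w N k) \<longlonglongrightarrow> u k" for k
    unfolding w_def u_def by (rule summable_LIMSEQ[OF summ])
  have w_L2: "L2_set (w N) G \<le> (\<Sum>n<N. \<tau> * \<rho> ^ n)" if "finite G" for N G
  proof (induction N)
    case 0
    then show ?case by (simp add: w_def L2_set_def)
  next
    case (Suc N)
    have "L2_set (w (Suc N)) G \<le> L2_set (w N) G + L2_set (\<lambda>k. \<tau> * ?r N k) G"
      unfolding w_Suc by (rule L2_set_triangle_ineq)
    also have "L2_set (\<lambda>k. \<tau> * ?r N k) G = \<tau> * L2_set (?r N) G"
      using tau_pos by (intro L2_set_right_distrib[symmetric]) simp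
    also have "\<dots> \<le> \<tau> * \<rho> ^ N"
      using tau_pos r[OF that] by (intro mult_left_mono) auto
    finally show ?case using Suc by simp
  qed
  have w_L2': "L2_set (w N) G \<le> \<tau> / (1 - \<rho>)" if "finite G" for N G
  proof -
    have "(\<Sum>n<N. \<tau> * \<rho> ^ n) \<le> (\<Sum>n. \<tau> * \<rho> ^ n)"
      using tau_pos rho_nonneg by (intro sum_le_suminf geom) auto
    also have "\<dots> = \<tau> / (1 - \<rho>)"
      using rho_nonneg rho_less_1 suminf_geometric[of \<rho>] by (subst suminf_mult) auto
    finally show ?thesis using w_L2[OF that, of N] by linarith
  qed
  have u_L2: "L2_set u G \<le> \<tau> / (1 - \<rho>)" if "finite G" for G
  proof (rule tendsto_upperbound)
    show "(\<lambda>N. L2_set (w N) G) \<longlonglongrightarrow> L2_set u G"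
      unfolding L2_set_def by (intro tendsto_intros w_tendsto)
  qed (use w_L2'[OF that] in auto)
  \<comment> \<open>The tail bound is uniform in \<open>k\<close>. Pointwise convergence of
    \<open>w N\<close> alone would not allow the limit to pass through the infinite sum in
    \<open>app\<close>.\<close>
  have u_diff: "\<bar>u k - w N k\<bar> \<le> \<tau> / (1 - \<rho>) * \<rho> ^ N" for k N
  proof -
    have "u k - w N k = (\<Sum>n. \<tau> * ?r (n + N) k)"
      unfolding u_def w_def using suminf_minus_initial_segment[OF summ] by simp
    also have "norm \<dots> \<le> (\<Sum>n. \<tau> * \<rho> ^ N * \<rho> ^ n)"
    proof (rule norm_suminf_le)
      show "norm (\<tau> * ?r (n + N) k) \<le> \<tau> * \<rho> ^ N * \<rho> ^ n" for n
        using r_le[of "n + N" k] tau_pos by (simp add: abs_mult mult.assoc power_add mult.commute mult_left_mono)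
      show "summable (\<lambda>n. \<tau> * \<rho> ^ N * \<rho> ^ n)"
        using rho_nonneg rho_less_1 by (intro summable_mult summable_geometric) simp
    qed
    also have "\<dots> = \<tau> / (1 - \<rho>) * \<rho> ^ N"
      using rho_nonneg rho_less_1 suminf_geometric[of \<rho>] by (subst suminf_mult) auto
    finally show ?thesis by simp
  qed
  have w_le: "\<bar>w N k\<bar> \<le> \<tau> / (1 - \<rho>)" for N k
    using abs_le_L2_set[of "{k}" k "w N"] w_L2'[of "{k}" N] by simp
  have u_le: "\<bar>u k\<bar> \<le> \<tau> / (1 - \<rho>)" for k
    using abs_le_L2_set[of "{k}" k u] u_L2[of "{k}"] by simp
  \<comment> \<open>Telescoping: each increment \<open>\<tau> * residual e N\<close> removes from
    the right-hand side what one iteration removes from the residual.\<close>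
  have app_w: "app (w N) j = e j - ?r N j" for N j
  proof (induction N)
    case 0
    then show ?case by (simp add: w_def)
  next
    case (Suc N)
    have "app (w (Suc N)) j = (\<Sum>\<^sub>\<infinity>k. M j k * w N k + \<tau> * (M j k * ?r N k))"
      by (intro infsum_cong) (simp add: w_def algebra_simps)
    also have "\<dots> = app (w N) j + \<tau> * app (?r N) j"
      using summable_app[where v = "w N" and j = j, OF w_le] summable_app[where v = "?r N" and j = j, OF r_le]
      by (simp add: infsum_add summable_on_cmult_right infsum_cmult_right)
    finally show ?case using Suc by simp
  qed
  have "app u j = e j" for j
  proof -
    have "\<bar>app u j - e j\<bar> \<le> (S * (\<tau> / (1 - \<rho>)) + 1) * \<rho> ^ N" for N
    proof -
      have "app u j - app (w N) j = app (\<lambda>k. u k - w N k) j"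
        using infsum_add[OF summable_app[where v = "w N" and j = j, OF w_le]
            summable_app[where v = "\<lambda>k. u k - w N k" and j = j, OF u_diff]]
        by (simp flip: distrib_left)
      also have "\<bar>\<dots>\<bar> \<le> S * (\<tau> / (1 - \<rho>) * \<rho> ^ N)"
        by (rule abs_app_le[OF u_diff])
      finally have "\<bar>app u j - e j + ?r N j\<bar> \<le> S * (\<tau> / (1 - \<rho>)) * \<rho> ^ N"
        by (simp add: app_w)
      then show ?thesis using r_le[of N j] by (simp add: distrib_right)
    qed
    moreover have "(\<lambda>N. (S * (\<tau> / (1 - \<rho>)) + 1) * \<rho> ^ N) \<longlonglongrightarrow> (S * (\<tau> / (1 - \<rho>)) + 1) * 0"
      using rho_nonneg rho_less_1 by (intro tendsto_intros LIMSEQ_power_zero) simp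
    ultimately have "\<bar>app u j - e j\<bar> \<le> (S * (\<tau> / (1 - \<rho>)) + 1) * 0"
      by (intro tendsto_lowerbound) auto
    then show ?thesis by simp
  qed
  with u_L2 show ?thesis by blast
qed

end

subsection \<open>Exponential decay of the inverse\<close>

lemma quasi_uniform_diff:
  assumes "quasi_uniform q Q x" "k \<le> l"
  shows "q * real_of_int (l - k) \<le> x l - x k" "x l - x k \<le> Q * real_of_int (l - k)"
proof -
  have "q * real_of_int (l - k) \<le> x l - x k \<and> x l - x k \<le> Q * real_of_int (l - k)"
    using assms(2)
  proof (induction l rule: int_ge_induct)
    case (step l)
    then show ?case
      using assms(1) by (auto simp: quasi_uniform_def algebra_simps dest: spec[of _ l])
  qed simp
  then show "q * real_of_int (l - k) \<le> x l - x k" "x l - x k \<le> Q * real_of_int (l - k)"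
    by auto
qed

lemma quasi_uniform_dist:
  assumes "quasi_uniform q Q x" "0 < q"
  shows "q * \<bar>real_of_int (j - k)\<bar> \<le> \<bar>x j - x k\<bar>" "\<bar>x j - x k\<bar> \<le> Q * \<bar>real_of_int (j - k)\<bar>"
proof -
  have le: "q * \<bar>real_of_int (j - k)\<bar> \<le> \<bar>x j - x k\<bar> \<and> \<bar>x j - x k\<bar> \<le> Q * \<bar>real_of_int (j - k)\<bar>"
    if "k \<le> j" for j k
  proof -
    have "0 \<le> q * real_of_int (j - k)" using that assms(2) by simp
    then show ?thesis
      using quasi_uniform_diff[OF assms(1) that] that by simp
  qed
  then show "q * \<bar>real_of_int (j - k)\<bar> \<le> \<bar>x j - x k\<bar>" "\<bar>x j - x k\<bar> \<le> Q * \<bar>real_of_int (j - k)\<bar>"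
    using le[of k j] le[of j k] by (cases "k \<le> j"; simp add: abs_minus_commute)+
qed

text \<open>Completing the square in \<open>\<bar>s\<bar>\<close>. The rate \<open>1 / q\<close> is
  matched to the separation: between nodes \<open>j\<close> and \<open>k\<close> it yields decay at
  least \<open>exp (- \<bar>j - k\<bar>)\<close>.\<close>

lemma gaussian_le_exp_abs:
  fixes lam q s :: real
  assumes "0 < lam" "0 < q"
  shows "exp (- lam * s\<^sup>2) \<le> exp (1 / (4 * lam * q\<^sup>2)) * exp (- \<bar>s\<bar> / q)"
proof -
  have "0 \<le> lam * (\<bar>s\<bar> - 1 / (2 * lam * q))\<^sup>2" using assms by simp
  also have "\<dots> = lam * s\<^sup>2 - \<bar>s\<bar> / q + 1 / (4 * lam * q\<^sup>2)"
    using assms by (simp add: power2_diff field_simps) (simp add: power2_eq_square power4_eq_xxxx)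
  finally show ?thesis by (simp flip: exp_add)
qed

lemma abs_exp_minus_1_le: "\<bar>exp a - 1\<bar> \<le> \<bar>a\<bar> * exp \<bar>a :: real\<bar>"
proof (cases "0 \<le> a")
  case True
  have "(1 - a) * exp a \<le> exp (- a) * exp a"
    using exp_ge_add_one_self[of "- a"] by (intro mult_right_mono) auto
  then have "exp a - 1 \<le> a * exp a" by (simp add: left_diff_distrib flip: exp_add)
  then show ?thesis using True by simp
next
  case False
  have "1 - exp a \<le> \<bar>a\<bar>" using exp_ge_add_one_self[of a] False by linarith
  also have "\<dots> \<le> \<bar>a\<bar> * exp \<bar>a\<bar>"
    using mult_left_mono[of 1 "exp \<bar>a\<bar>" "\<bar>a\<bar>"] by simp
  finally show ?thesis using False by simp
qed

text \<open>The Combes--Thomas argument: conjugating by a slowly growing exponential weight perturbs the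
  matrix by a small operator, hence preserves coercivity.\<close>

lemma weighted_gaussian_coercive:
  assumes "0 < lam" "0 < q"
  obtains \<epsilon> C \<theta> where "0 < \<epsilon>"
    "\<And>x w. \<lbrakk>\<And>j k. q * \<bar>real_of_int (j - k)\<bar> \<le> \<bar>x j - x k\<bar>;
        \<And>j k. \<bar>w j - w k\<bar> \<le> \<epsilon> * \<bar>real_of_int (j - k)\<bar>\<rbrakk> \<Longrightarrow>
      coercive_matrix (\<lambda>j k. exp (w j - w k) * exp (- lam * (x j - x k)\<^sup>2))
        (\<lambda>n. C * exp (- (1 / 2) * \<bar>real_of_int n\<bar>)) \<theta>"
proof -
  define C where "C = exp (1 / (4 * lam * q\<^sup>2))"
  \<comment> \<open>Rescaling the nodes by \<open>\<mu>\<close> turns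
    \<open>exp (- lam * d^2)\<close> into \<open>exp (- d^2 / 2)\<close>, the normalisation of the
    coercivity estimate.\<close>
  define \<mu> where "\<mu> = sqrt (2 * lam)"
  have C: "0 < C" and \<mu>: "0 < \<mu>" using assms by (auto simp: C_def \<mu>_def)
  \<comment> \<open>The rate \<open>1 / 4\<close> is what remains of the entry decay with rate 1
    after giving \<open>1 / 2\<close> to the growth of the weights and \<open>1 / 4\<close> to the
    factor \<open>\<bar>j - k\<bar>\<close> coming from \<open>exp (w j - w k) - 1\<close>.\<close>
  let ?h = "\<lambda>n::int. exp (- (1 / 4) * \<bar>real_of_int n\<bar>)"
  have h: "?h summable_on UNIV" by (rule exp_abs_summable_on_int) simp
  define S where "S = infsum ?h UNIV"
  have "?h 0 \<le> S"
    using finite_sum_le_infsum[OF h, of "{0}"] by (simp add: S_def)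
  then have S: "0 < S" by simp
  obtain \<theta> where \<theta>: "0 < \<theta>" and coer: "\<And>(z :: int \<Rightarrow> real) F v.
      \<lbrakk>\<And>j k. \<mu> * q * \<bar>real_of_int (j - k)\<bar> \<le> \<bar>z j - z k\<bar>; finite F\<rbrakk> \<Longrightarrow>
      \<theta> * (\<Sum>j\<in>F. (v j)\<^sup>2) \<le> (\<Sum>j\<in>F. \<Sum>k\<in>F. v j * v k * exp (- (z j - z k)\<^sup>2 / 2))"
    using gaussian_quad_ge[of "\<mu> * q"] \<mu> assms by auto
  \<comment> \<open>The first entry leaves the conjugated matrix a kernel of rate
    \<open>1 / 2\<close>; the second limits the perturbation to half of the coercivity
    constant.\<close>
  define \<epsilon> where "\<epsilon> = min (1 / 2) (\<theta> / (8 * C * S))"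
  have \<epsilon>: "0 < \<epsilon>" "\<epsilon> \<le> 1 / 2" "4 * C * \<epsilon> * S \<le> \<theta> / 2"
  proof -
    show "0 < \<epsilon>" "\<epsilon> \<le> 1 / 2" using \<theta> C S by (auto simp: \<epsilon>_def)
    have "4 * C * \<epsilon> * S \<le> 4 * C * (\<theta> / (8 * C * S)) * S"
      using C S by (intro mult_right_mono mult_left_mono) (auto simp: \<epsilon>_def)
    also have "\<dots> = \<theta> / 2" using C S by (simp add: field_simps)
    finally show "4 * C * \<epsilon> * S \<le> \<theta> / 2" .
  qed
  show ?thesis
  proof (rule that[of \<epsilon> C "\<theta> / 2"])
    fix x w :: "int \<Rightarrow> real"
    assume sep: "\<And>j k. q * \<bar>real_of_int (j - k)\<bar> \<le> \<bar>x j - x k\<bar>"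
      and w: "\<And>j k. \<bar>w j - w k\<bar> \<le> \<epsilon> * \<bar>real_of_int (j - k)\<bar>"
    let ?A = "\<lambda>j k. exp (- lam * (x j - x k)\<^sup>2)"
    have A_le: "?A j k \<le> C * exp (- \<bar>real_of_int (j - k)\<bar>)" for j k
    proof -
      have "?A j k \<le> C * exp (- \<bar>x j - x k\<bar> / q)"
        unfolding C_def by (rule gaussian_le_exp_abs[OF assms])
      also have "\<dots> \<le> C * exp (- \<bar>real_of_int (j - k)\<bar>)"
        using sep[of j k] assms(2) C by (simp add: field_simps)
      finally show ?thesis .
    qed
    have w_half: "\<bar>w j - w k\<bar> \<le> 1 / 2 * \<bar>real_of_int (j - k)\<bar>" for j k
      using w[of j k] mult_right_mono[OF \<epsilon>(2), of "\<bar>real_of_int (j - k)\<bar>"] by linarith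
    have pert: "?A j k * \<bar>exp (w j - w k) - 1\<bar> \<le> 4 * C * \<epsilon> * ?h (j - k)" for j k
    proof -
      let ?m = "\<bar>real_of_int (j - k)\<bar>"
      have "m \<le> 4 * exp (1 / 4 * m)" for m :: real
        using exp_ge_add_one_self[of "1 / 4 * m"] by linarith
      then have "\<bar>w j - w k\<bar> \<le> \<epsilon> * (4 * exp (1 / 4 * ?m))"
        using w[of j k] \<epsilon>(1) by (meson mult_left_mono order_trans less_imp_le)
      then have "\<bar>w j - w k\<bar> * exp \<bar>w j - w k\<bar> \<le> (\<epsilon> * (4 * exp (1 / 4 * ?m))) * exp (1 / 2 * ?m)"
        using w_half[of j k] \<epsilon>(1) by (intro mult_mono) auto
      with abs_exp_minus_1_le[of "w j - w k"]
      have "?A j k * \<bar>exp (w j - w k) - 1\<bar>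
          \<le> (C * exp (- ?m)) * ((\<epsilon> * (4 * exp (1 / 4 * ?m))) * exp (1 / 2 * ?m))"
        using C by (intro mult_mono A_le) auto
      also have "\<dots> = 4 * C * \<epsilon> * (exp (- ?m) * exp (1 / 4 * ?m) * exp (1 / 2 * ?m))"
        by (simp only: mult_ac)
      also have "exp (- ?m) * exp (1 / 4 * ?m) * exp (1 / 2 * ?m) = ?h (j - k)"
        by (simp flip: exp_add)
      finally show ?thesis .
    qed
    show "coercive_matrix (\<lambda>j k. exp (w j - w k) * ?A j k)
        (\<lambda>n. C * exp (- (1 / 2) * \<bar>real_of_int n\<bar>)) (\<theta> / 2)"
    proof
      show "(\<lambda>n::int. C * exp (- (1 / 2) * \<bar>real_of_int n\<bar>)) summable_on UNIV"
        by (intro summable_on_cmult_right exp_abs_summable_on_int) simp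
      show "0 < \<theta> / 2" using \<theta> by simp
      fix j k
      have "exp (w j - w k) * ?A j k \<le> exp (1 / 2 * \<bar>real_of_int (j - k)\<bar>) * (C * exp (- \<bar>real_of_int (j - k)\<bar>))"
        using order_trans[OF abs_ge_self w_half[of j k]] by (intro mult_mono A_le) auto
      also have "\<dots> = C * exp (- (1 / 2) * \<bar>real_of_int (j - k)\<bar>)"
        by (simp flip: exp_add)
      finally show "\<bar>exp (w j - w k) * ?A j k\<bar> \<le> C * exp (- (1 / 2) * \<bar>real_of_int (j - k)\<bar>)"
        by (simp add: abs_mult)
    next
      fix F :: "int set" and v :: "int \<Rightarrow> real"
      assume F: "finite F"
      let ?V = "\<Sum>j\<in>F. (v j)\<^sup>2"
      have "\<theta> * ?V \<le> (\<Sum>j\<in>F. \<Sum>k\<in>F. v j * v k * exp (- (\<mu> * x j - \<mu> * x k)\<^sup>2 / 2))"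
        using sep \<mu> F
        by (intro coer) (simp_all add: mult.assoc abs_mult flip: right_diff_distrib)
      also have "\<dots> = (\<Sum>j\<in>F. \<Sum>k\<in>F. v j * v k * ?A j k)"
        using assms(1) by (simp add: \<mu>_def power_mult_distrib flip: right_diff_distrib)
      finally have main: "\<theta> * ?V \<le> (\<Sum>j\<in>F. \<Sum>k\<in>F. v j * v k * ?A j k)" .
      have "(\<Sum>j\<in>F. \<Sum>k\<in>F. 4 * C * \<epsilon> * (?h (j - k) * (\<bar>v j\<bar> * \<bar>v k\<bar>)))
          = 4 * C * \<epsilon> * (\<Sum>j\<in>F. \<Sum>k\<in>F. ?h (j - k) * (\<bar>v j\<bar> * \<bar>v k\<bar>))"
        by (simp only: sum_distrib_left)
      also have "\<dots> \<le> 4 * C * \<epsilon> * (S * ?V)"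
        unfolding S_def using C \<epsilon>(1) by (intro mult_left_mono schur_bilinear h F) auto
      also have "\<dots> \<le> \<theta> / 2 * ?V"
        using mult_right_mono[OF \<epsilon>(3), of ?V] by (simp add: sum_nonneg mult.assoc)
      finally have err: "(\<Sum>j\<in>F. \<Sum>k\<in>F. 4 * C * \<epsilon> * (?h (j - k) * (\<bar>v j\<bar> * \<bar>v k\<bar>))) \<le> \<theta> / 2 * ?V" .
      have "(\<Sum>j\<in>F. \<Sum>k\<in>F. v j * v k * ?A j k - 4 * C * \<epsilon> * (?h (j - k) * (\<bar>v j\<bar> * \<bar>v k\<bar>)))
          \<le> (\<Sum>j\<in>F. \<Sum>k\<in>F. v j * v k * (exp (w j - w k) * ?A j k))"
      proof (intro sum_mono)
        fix j k
        have "\<bar>v j * v k * (?A j k * (exp (w j - w k) - 1))\<bar> = \<bar>v j\<bar> * \<bar>v k\<bar> * (?A j k * \<bar>exp (w j - w k) - 1\<bar>)"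
          by (simp add: abs_mult)
        also have "\<dots> \<le> \<bar>v j\<bar> * \<bar>v k\<bar> * (4 * C * \<epsilon> * ?h (j - k))"
          by (intro mult_left_mono pert) simp
        also have "\<dots> = 4 * C * \<epsilon> * (?h (j - k) * (\<bar>v j\<bar> * \<bar>v k\<bar>))"
          by (simp only: mult_ac)
        finally have *: "- (4 * C * \<epsilon> * (?h (j - k) * (\<bar>v j\<bar> * \<bar>v k\<bar>))) \<le> v j * v k * (?A j k * (exp (w j - w k) - 1))"
          by (metis abs_le_D2 minus_le_iff)
        have "v j * v k * (exp (w j - w k) * ?A j k) = v j * v k * ?A j k + v j * v k * (?A j k * (exp (w j - w k) - 1))"
          by (simp add: algebra_simps)
        with * show "v j * v k * ?A j k - 4 * C * \<epsilon> * (?h (j - k) * (\<bar>v j\<bar> * \<bar>v k\<bar>)) \<le> v j * v k * (exp (w j - w k) * ?A j k)"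
          by (smt (verit))
      qed
      with main err show "\<theta> / 2 * ?V \<le> (\<Sum>j\<in>F. \<Sum>k\<in>F. v j * v k * (exp (w j - w k) * ?A j k))"
        by (simp add: sum_subtractf)
    qed
  qed (rule \<epsilon>(1))
qed

text \<open>Conjugation by a weight vanishing at \<open>l\<close> leaves the right-hand side
  \<open>b\<close> unchanged, so the solution bound controls the weighted solution. The value
  \<open>b l\<close> may be any number of modulus at most 1: the real part of a column of the
  inverse has 1 there and the imaginary part has 0.\<close>

lemma gaussian_solution_decay:
  assumes "0 < lam" "0 < q"
  obtains \<epsilon> K where "0 < \<epsilon>"
    "\<And>x u b B k l. \<lbrakk>\<And>j k. q * \<bar>real_of_int (j - k)\<bar> \<le> \<bar>x j - x k\<bar>;
        \<And>G. finite G \<Longrightarrow> L2_set u G \<le> B;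
        \<And>j. (\<Sum>\<^sub>\<infinity>k. exp (- lam * (x j - x k)\<^sup>2) * u k) = b j;
        \<And>j. j \<noteq> l \<Longrightarrow> b j = 0; \<bar>b l\<bar> \<le> 1\<rbrakk> \<Longrightarrow>
      \<bar>u k\<bar> \<le> K * exp (- \<epsilon> * \<bar>real_of_int (k - l)\<bar>)"
proof (rule weighted_gaussian_coercive[OF assms])
  fix \<epsilon> C \<theta> :: real
  assume \<epsilon>: "0 < \<epsilon>" and coer:
    "\<And>x w.
      \<lbrakk>\<And>j k. q * \<bar>real_of_int (j - k)\<bar> \<le> \<bar>x j - x k\<bar>;
        \<And>j k. \<bar>w j - w k\<bar> \<le> \<epsilon> * \<bar>real_of_int (j - k)\<bar>\<rbrakk> \<Longrightarrow>
      coercive_matrix (\<lambda>j k. exp (w j - w k) * exp (- lam * (x j - x k)\<^sup>2))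
        (\<lambda>n. C * exp (- (1 / 2) * \<bar>real_of_int n\<bar>)) \<theta>"
  let ?f = "\<lambda>n. C * exp (- (1 / 2) * \<bar>real_of_int n\<bar>)"
  \<comment> \<open>The locale constants are formed from the kernel and \<open>\<theta>\<close>
    before any nodes or weights exist, so \<open>K\<close> serves all of them.\<close>
  define K where "K = coercive_matrix.\<tau> ?f \<theta> * 1 / (1 - coercive_matrix.\<rho> ?f \<theta>)"
  show thesis
  proof (rule that[OF \<epsilon>, of K])
    fix x u b :: "int \<Rightarrow> real" and B k l
    assume sep: "\<And>j k. q * \<bar>real_of_int (j - k)\<bar> \<le> \<bar>x j - x k\<bar>"
      and u: "\<And>G. finite G \<Longrightarrow> L2_set u G \<le> B"
      and Au: "\<And>j. (\<Sum>\<^sub>\<infinity>k. exp (- lam * (x j - x k)\<^sup>2) * u k) = b j"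
      and b: "\<And>j. j \<noteq> l \<Longrightarrow> b j = 0" "\<bar>b l\<bar> \<le> 1"
    define N where "N = \<bar>real_of_int (k - l)\<bar>"
    \<comment> \<open>Truncation at the distance \<open>N\<close> from \<open>l\<close> to the
      target index \<open>k\<close> keeps the weighted sequence square summable, while the weight at
      \<open>k\<close> still has its full value \<open>\<epsilon> * N\<close>.\<close>
    define w where "w j = \<epsilon> * min \<bar>real_of_int (j - l)\<bar> N" for j
    have w_lip: "\<bar>w j - w k\<bar> \<le> \<epsilon> * \<bar>real_of_int (j - k)\<bar>" for j k
    proof -
      have "\<bar>min \<bar>real_of_int (j - l)\<bar> N - min \<bar>real_of_int (k - l)\<bar> N\<bar> \<le> \<bar>real_of_int (j - k)\<bar>"
        by (auto simp: min_def)
      then show ?thesis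
        unfolding w_def right_diff_distrib[symmetric] abs_mult using \<epsilon> by simp
    qed
    interpret W: coercive_matrix "\<lambda>j k. exp (w j - w k) * exp (- lam * (x j - x k)\<^sup>2)" ?f \<theta>
      by (rule coer[OF sep w_lip])
    define v where "v j = exp (w j) * u j" for j
    have v_L2: "L2_set v G \<le> exp (\<epsilon> * N) * B" if "finite G" for G
    proof -
      have "L2_set v G \<le> L2_set (\<lambda>j. exp (\<epsilon> * N) * \<bar>u j\<bar>) G"
        unfolding L2_set_def
      proof (intro real_sqrt_le_mono sum_mono)
        fix j
        have "\<bar>v j\<bar> \<le> \<bar>exp (\<epsilon> * N) * \<bar>u j\<bar>\<bar>"
          using \<epsilon> by (simp add: v_def w_def abs_mult mult_right_mono)
        then show "(v j)\<^sup>2 \<le> (exp (\<epsilon> * N) * \<bar>u j\<bar>)\<^sup>2"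
          by (simp only: abs_le_square_iff)
      qed
      also have "\<dots> = exp (\<epsilon> * N) * L2_set (\<lambda>j. \<bar>u j\<bar>) G"
        by (intro L2_set_right_distrib[symmetric]) simp
      also have "\<dots> = exp (\<epsilon> * N) * L2_set u G"
        by (simp add: L2_set_def)
      also have "\<dots> \<le> exp (\<epsilon> * N) * B"
        using u[OF that] by simp
      finally show ?thesis .
    qed
    \<comment> \<open>The factors \<open>exp (- w k)\<close> of the matrix and
      \<open>exp (w k)\<close> of \<open>v\<close> cancel, leaving \<open>exp (w j) * b j\<close>;
      this is \<open>b j\<close> because \<open>w l = 0\<close> and \<open>b\<close> vanishes
      elsewhere.\<close>
    have app_v: "W.app v j = b j" for j
    proof -
      have "W.app v j = (\<Sum>\<^sub>\<infinity>k. exp (w j) * (exp (- lam * (x j - x k)\<^sup>2) * u k))"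
        by (intro infsum_cong) (simp add: v_def exp_diff)
      also have "\<dots> = exp (w j) * b j"
        by (simp only: infsum_cmult_right' Au)
      also have "\<dots> = b j"
        using b(1)[of j] by (cases "j = l") (auto simp: w_def N_def)
      finally show ?thesis .
    qed
    have "L2_set (W.app v) G \<le> 1" if "finite G" for G
    proof -
      have "L2_set (W.app v) G = L2_set b G" by (simp only: app_v)
      also have "\<dots> \<le> (\<Sum>j\<in>G. \<bar>b j\<bar>)" by (rule L2_set_le_sum_abs)
      also have "\<dots> \<le> (\<Sum>j\<in>G. if j = l then 1 else 0)"
        using b by (intro sum_mono) auto
      also have "\<dots> \<le> 1" using that by simp
      finally show ?thesis .
    qed
    from W.solution_bound[OF v_L2 this, of "{k}"] have "L2_set v {k} \<le> K"
      by (simp add: K_def)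
    then have "\<bar>v k\<bar> \<le> K" using abs_le_L2_set[of "{k}" k v] by simp
    then have "exp (- \<epsilon> * N) * (exp (\<epsilon> * N) * \<bar>u k\<bar>) \<le> exp (- \<epsilon> * N) * K"
      by (simp add: v_def w_def N_def abs_mult)
    also have "exp (- \<epsilon> * N) * (exp (\<epsilon> * N) * \<bar>u k\<bar>) = \<bar>u k\<bar>"
      unfolding mult.assoc[symmetric] exp_add[symmetric] by simp
    finally show "\<bar>u k\<bar> \<le> K * exp (- \<epsilon> * \<bar>real_of_int (k - l)\<bar>)"
      unfolding N_def by (simp only: mult.commute)
  qed
qed

section \<open>Complex solutions and the columns of the inverse\<close>

lemma ell_space_2: "ell_space 2 = {y. (\<lambda>l. (norm (y l))\<^sup>2) summable_on UNIV}"
  by (simp add: ell_space_def)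

text \<open>The coercivity argument is real, and the Gaussian entries are real, so a complex
  equation splits into two real ones. Absolute summability of each row justifies taking
  \<open>Re\<close> and \<open>Im\<close> inside the infinite sum.\<close>

lemma complex_solution_components:
  assumes sep: "\<And>j k. q * \<bar>real_of_int (j - k)\<bar> \<le> \<bar>x j - x k\<bar>" and pos: "0 < lam" "0 < q"
    and u: "u \<in> ell_space 2"
  shows "(\<Sum>\<^sub>\<infinity>k. exp (- lam * (x j - x k)\<^sup>2) * Re (u k)) = Re (matrix_apply (gauss_matrix lam x) u j)"
    and "(\<Sum>\<^sub>\<infinity>k. exp (- lam * (x j - x k)\<^sup>2) * Im (u k)) = Im (matrix_apply (gauss_matrix lam x) u j)"
    and "finite G \<Longrightarrow> L2_set (\<lambda>k. Re (u k)) G \<le> sqrt (\<Sum>\<^sub>\<infinity>k. (norm (u k))\<^sup>2)"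
    and "finite G \<Longrightarrow> L2_set (\<lambda>k. Im (u k)) G \<le> sqrt (\<Sum>\<^sub>\<infinity>k. (norm (u k))\<^sup>2)"
proof -
  let ?B = "\<Sum>\<^sub>\<infinity>k. (norm (u k))\<^sup>2"
  have sum: "(\<lambda>k. (norm (u k))\<^sup>2) summable_on UNIV"
    using u by (simp only: ell_space_2 mem_Collect_eq)
  have fin: "(\<Sum>k\<in>G. (norm (u k))\<^sup>2) \<le> ?B" if "finite G" for G
    using that by (intro finite_sum_le_infsum sum) auto
  have "(norm (u k))\<^sup>2 \<le> ?B" for k using fin[of "{k}"] by simp
  then have u_le: "norm (u k) \<le> sqrt ?B" for k by (rule real_le_rsqrt)
  let ?C = "exp (1 / (4 * lam * q\<^sup>2))"
  have "(\<lambda>k. norm (gauss_matrix lam x j k * u k)) summable_on UNIV"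
  proof (rule Infinite_Sum.abs_summable_on_comparison_test')
    show "(\<lambda>k. ?C * exp (- 1 * \<bar>real_of_int (j - k)\<bar>) * sqrt ?B) summable_on UNIV"
      by (intro summable_on_cmult_right summable_on_cmult_left
          summable_on_int_reflect[where f = "\<lambda>n. exp (- 1 * \<bar>real_of_int n\<bar>)"] exp_abs_summable_on_int) simp
    fix k
    have "exp (- lam * (x j - x k)\<^sup>2) \<le> ?C * exp (- \<bar>x j - x k\<bar> / q)"
      by (rule gaussian_le_exp_abs[OF pos])
    also have "\<dots> \<le> ?C * exp (- 1 * \<bar>real_of_int (j - k)\<bar>)"
      using sep[of j k] pos by (simp add: field_simps)
    finally show "norm (gauss_matrix lam x j k * u k) \<le> ?C * exp (- 1 * \<bar>real_of_int (j - k)\<bar>) * sqrt ?B"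
      unfolding norm_mult using u_le[of k] by (intro mult_mono) (auto simp: gauss_matrix_def gauss_def)
  qed
  then have "(\<lambda>k. gauss_matrix lam x j k * u k) summable_on UNIV"
    by (rule abs_summable_summable)
  then have *: "((\<lambda>k. gauss_matrix lam x j k * u k) has_sum matrix_apply (gauss_matrix lam x) u j) UNIV"
    by (simp add: matrix_apply_def)
  show "(\<Sum>\<^sub>\<infinity>k. exp (- lam * (x j - x k)\<^sup>2) * Re (u k)) = Re (matrix_apply (gauss_matrix lam x) u j)"
    using has_sum_Re[OF *] by (intro infsumI) (simp add: gauss_matrix_def gauss_def)
  show "(\<Sum>\<^sub>\<infinity>k. exp (- lam * (x j - x k)\<^sup>2) * Im (u k)) = Im (matrix_apply (gauss_matrix lam x) u j)"
    using has_sum_Im[OF *] by (intro infsumI) (simp add: gauss_matrix_def gauss_def)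
  have le: "L2_set g G \<le> sqrt ?B" if "finite G" "\<And>k. \<bar>g k\<bar> \<le> norm (u k)" for g :: "int \<Rightarrow> real" and G
  proof -
    have "(\<Sum>k\<in>G. (g k)\<^sup>2) \<le> (\<Sum>k\<in>G. (norm (u k))\<^sup>2)"
      using that(2) by (intro sum_mono) (simp flip: abs_le_square_iff)
    then show ?thesis
      unfolding L2_set_def using fin[OF that(1)] by simp
  qed
  show "finite G \<Longrightarrow> L2_set (\<lambda>k. Re (u k)) G \<le> sqrt ?B"
    by (rule le) (auto intro: abs_Re_le_cmod)
  show "finite G \<Longrightarrow> L2_set (\<lambda>k. Im (u k)) G \<le> sqrt ?B"
    by (rule le) (auto intro: abs_Im_le_cmod)
qed

lemma unit_vector_in_range:
  assumes sep: "\<And>j k. q * \<bar>real_of_int (j - k)\<bar> \<le> \<bar>x j - x k\<bar>" and pos: "0 < lam" "0 < q"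
  shows "(\<lambda>j. if j = l then 1 else 0) \<in> matrix_apply (gauss_matrix lam x) ` ell_space 2"
proof (rule weighted_gaussian_coercive[OF pos])
  fix \<epsilon> C \<theta> :: real
  assume \<epsilon>: "0 < \<epsilon>" and coer:
    "\<And>x w.
      \<lbrakk>\<And>j k. q * \<bar>real_of_int (j - k)\<bar> \<le> \<bar>x j - x k\<bar>;
        \<And>j k. \<bar>w j - w k\<bar> \<le> \<epsilon> * \<bar>real_of_int (j - k)\<bar>\<rbrakk> \<Longrightarrow>
      coercive_matrix (\<lambda>j k. exp (w j - w k) * exp (- lam * (x j - x k)\<^sup>2))
        (\<lambda>n. C * exp (- (1 / 2) * \<bar>real_of_int n\<bar>)) \<theta>"
  let ?e = "\<lambda>j. if j = l then 1 else 0 :: real"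
  \<comment> \<open>The weight 0 turns the conjugated matrix into the Gaussian matrix
    itself.\<close>
  have "coercive_matrix (\<lambda>j k. exp (0 - 0) * exp (- lam * (x j - x k)\<^sup>2))
        (\<lambda>n. C * exp (- (1 / 2) * \<bar>real_of_int n\<bar>)) \<theta>"
    using \<epsilon> by (intro coer[OF sep, where w = "\<lambda>_. 0"]) simp
  then interpret W: coercive_matrix "\<lambda>j k. exp (- lam * (x j - x k)\<^sup>2)"
      "\<lambda>n. C * exp (- (1 / 2) * \<bar>real_of_int n\<bar>)" \<theta>
    by simp
  have "L2_set ?e G \<le> 1" if "finite G" for G
    using that L2_set_le_sum_abs[of ?e G] by (auto simp: sum.delta split: if_splits)
  then obtain u B where u: "\<And>G. finite G \<Longrightarrow> L2_set u G \<le> B" and Au: "\<And>j. W.app u j = ?e j"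
    using W.solution_exists[of ?e] by blast
  have "(\<lambda>k. (u k)\<^sup>2) summable_on UNIV"
  proof (rule nonneg_bdd_above_summable_on)
    show "bdd_above (sum (\<lambda>k. (u k)\<^sup>2) ` {F. F \<subseteq> UNIV \<and> finite F})"
    proof (rule bdd_aboveI2)
      fix F :: "int set" assume "F \<in> {F. F \<subseteq> UNIV \<and> finite F}"
      then show "(\<Sum>k\<in>F. (u k)\<^sup>2) \<le> B\<^sup>2"
        using u[of F] by (intro sqrt_le_D) (simp add: L2_set_def)
    qed
  qed simp
  then have mem: "(\<lambda>k. complex_of_real (u k)) \<in> ell_space 2"
    by (simp only: ell_space_2 mem_Collect_eq norm_of_real real_norm_def power2_abs)
  have "matrix_apply (gauss_matrix lam x) (\<lambda>k. complex_of_real (u k)) j = (if j = l then 1 else 0)" for j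
    using complex_solution_components(1,2)[OF sep pos mem, of j] Au[of j]
    by (intro complex_eqI) auto
  then have "matrix_apply (gauss_matrix lam x) (\<lambda>k. complex_of_real (u k)) = (\<lambda>j. if j = l then 1 else 0)"
    by blast
  with mem show ?thesis
    by (metis (no_types, lifting) image_eqI)
qed

lemma gauss_inv_column:
  assumes sep: "\<And>j k. q * \<bar>real_of_int (j - k)\<bar> \<le> \<bar>x j - x k\<bar>" and pos: "0 < lam" "0 < q"
  shows "(\<lambda>k. gauss_inv lam x k l) \<in> ell_space 2"
    and "matrix_apply (gauss_matrix lam x) (\<lambda>k. gauss_inv lam x k l) = (\<lambda>j. if j = l then 1 else 0)"
  using inv_into_into[OF unit_vector_in_range[OF assms, of l]] f_inv_into_f[OF unit_vector_in_range[OF assms, of l]]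
  by (simp_all add: gauss_inv_def gauss_inv_op_def)

text \<open>Column \<open>l\<close> is a square summable preimage of a real unit vector. Its real
  part is mapped to that vector and its imaginary part to zero, so both fall under the real decay
  estimate.\<close>

lemma gauss_inv_decay:
  assumes pos: "0 < lam" "0 < q"
  obtains \<epsilon> K where "0 < \<epsilon>" "0 < K"
    "\<And>x k l. (\<And>j k. q * \<bar>real_of_int (j - k)\<bar> \<le> \<bar>x j - x k\<bar>) \<Longrightarrow>
      norm (gauss_inv lam x k l) \<le> K * exp (- \<epsilon> * \<bar>real_of_int (k - l)\<bar>)"
proof (rule gaussian_solution_decay[OF pos])
  fix \<epsilon> K :: real
  assume \<epsilon>: "0 < \<epsilon>" and decay:
    "\<And>x u b B k l. \<lbrakk>\<And>j k. q * \<bar>real_of_int (j - k)\<bar> \<le> \<bar>x j - x k\<bar>;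
        \<And>G. finite G \<Longrightarrow> L2_set u G \<le> B;
        \<And>j. (\<Sum>\<^sub>\<infinity>k. exp (- lam * (x j - x k)\<^sup>2) * u k) = b j;
        \<And>j. j \<noteq> l \<Longrightarrow> b j = 0; \<bar>b l\<bar> \<le> 1\<rbrakk> \<Longrightarrow>
      \<bar>u k\<bar> \<le> K * exp (- \<epsilon> * \<bar>real_of_int (k - l)\<bar>)"
  show thesis
  \<comment> \<open>The factor 2 accounts for real and imaginary part; the absolute value and the
    summand 1 supply positivity, as no sign of \<open>K\<close> is recorded.\<close>
  proof (rule that[OF \<epsilon>, of "2 * \<bar>K\<bar> + 1"])
    fix x :: "int \<Rightarrow> real" and k l
    assume sep: "\<And>j k. q * \<bar>real_of_int (j - k)\<bar> \<le> \<bar>x j - x k\<bar>"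
    let ?u = "\<lambda>k. gauss_inv lam x k l"
    note col = gauss_inv_column[OF sep pos, of l]
    note comp = complex_solution_components[OF sep pos col(1)]
    have "\<bar>Re (?u k)\<bar> \<le> K * exp (- \<epsilon> * \<bar>real_of_int (k - l)\<bar>)"
      by (rule decay[OF sep comp(3) comp(1)]) (auto simp: col(2))
    moreover have "\<bar>Im (?u k)\<bar> \<le> K * exp (- \<epsilon> * \<bar>real_of_int (k - l)\<bar>)"
      by (rule decay[OF sep comp(4) comp(2)]) (auto simp: col(2))
    ultimately have "norm (?u k) \<le> 2 * K * exp (- \<epsilon> * \<bar>real_of_int (k - l)\<bar>)"
      using cmod_le[of "?u k"] by linarith
    also have "\<dots> \<le> (2 * \<bar>K\<bar> + 1) * exp (- \<epsilon> * \<bar>real_of_int (k - l)\<bar>)"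
      by (intro mult_right_mono) auto
    finally show "norm (?u k) \<le> (2 * \<bar>K\<bar> + 1) * exp (- \<epsilon> * \<bar>real_of_int (k - l)\<bar>)" .
  qed simp
qed

subsection \<open>The interpolant\<close>

lemma
  fixes f :: "'a \<Rightarrow> 'b::banach" and g :: "'a \<Rightarrow> real"
  assumes "(g has_sum T) A" "\<And>x. x \<in> A \<Longrightarrow> norm (f x) \<le> g x"
  shows dominated_summable_on: "f summable_on A"
    and norm_infsum_dominated_le: "norm (infsum f A) \<le> T"
proof -
  show "f summable_on A"
    using Infinite_Sum.abs_summable_on_comparison_test'[OF has_sum_imp_summable[OF assms(1)] assms(2)]
    by (rule abs_summable_summable)
  then show "norm (infsum f A) \<le> T"
    using assms by (intro norm_infsum_le[OF has_sum_infsum]) auto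
qed

section \<open>Exponential sums over the nodes\<close>

lemma quasi_uniform_bracket:
  assumes qu: "quasi_uniform q Q x" and q: "0 < q"
  obtains m where "x m \<le> t" "t < x (m + 1)"
proof -
  obtain n :: nat where n: "\<bar>t - x 0\<bar> < real n * q"
    using reals_Archimedean3[OF q] by blast
  have hi: "t < x (int n)" and lo: "x (- int n) \<le> t"
    using quasi_uniform_diff(1)[OF qu, of 0 "int n"] quasi_uniform_diff(1)[OF qu, of "- int n" 0] n
    by (auto simp: mult.commute)
  define A where "A = {k \<in> {- int n..int n}. x k \<le> t}"
  have A: "finite A" by (rule finite_subset[of _ "{- int n..int n}"]) (auto simp: A_def)
  have "- int n \<in> A" using lo by (auto simp: A_def)
  with A have m: "Max A \<in> A" by (intro Max_in) auto
  \<comment> \<open>The successor either leaves the index window or has its node beyond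
    \<open>t\<close>. The first would force \<open>Max A = int n\<close>, which \<open>hi\<close>
    excludes.\<close>
  have "Max A + 1 \<notin> A"
    using Max_ge[OF A, of "Max A + 1"] by auto
  moreover have "Max A \<noteq> int n" using m hi by (auto simp: A_def)
  ultimately have "t < x (Max A + 1)" using m by (auto simp: A_def)
  then show ?thesis using m by (intro that[of "Max A"]) (auto simp: A_def)
qed

text \<open>To the right of \<open>t\<close> gaps can be counted only from \<open>x (m + 1)\<close>,
  so one gap is lost; this is the term \<open>- q\<close>.\<close>

lemma quasi_uniform_dist_bracket:
  assumes qu: "quasi_uniform q Q x" and q: "0 < q" and m: "x m \<le> t" "t < x (m + 1)"
  shows "q * \<bar>real_of_int (l - m)\<bar> - q \<le> \<bar>t - x l\<bar>"
proof (cases "l \<le> m")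
  case True
  then show ?thesis
    using quasi_uniform_diff(1)[OF qu True] m q by (simp add: algebra_simps)
next
  case False
  then have "m + 1 \<le> l" by simp
  from quasi_uniform_diff(1)[OF qu this] show ?thesis
    using m q False by (simp add: algebra_simps)
qed

text \<open>The factor \<open>exp (\<delta> * q)\<close> pays for the lost gap. The bound is the
  same for all \<open>t\<close> and all node sequences with separation \<open>q\<close>.\<close>

lemma
  assumes qu: "quasi_uniform q Q x" and q: "0 < q" and \<delta>: "0 < \<delta>"
  shows exp_dist_summable: "(\<lambda>l. exp (- \<delta> * \<bar>t - x l\<bar>)) summable_on UNIV"
    and infsum_exp_dist_le:
      "(\<Sum>\<^sub>\<infinity>l. exp (- \<delta> * \<bar>t - x l\<bar>)) \<le> exp (\<delta> * q) * (\<Sum>\<^sub>\<infinity>n::int. exp (- (\<delta> * q) * \<bar>real_of_int n\<bar>))"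
proof -
  obtain m where m: "x m \<le> t" "t < x (m + 1)"
    by (rule quasi_uniform_bracket[OF qu q])
  let ?h = "\<lambda>n::int. exp (- (\<delta> * q) * \<bar>real_of_int n\<bar>)"
  have h: "?h summable_on UNIV" using q \<delta> by (intro exp_abs_summable_on_int) simp
  have sum: "((\<lambda>l. exp (\<delta> * q) * ?h (l - m)) has_sum exp (\<delta> * q) * infsum ?h UNIV) UNIV"
    using has_sum_infsum[OF summable_on_int_shift[OF h, of m]]
    unfolding infsum_int_shift[OF h] by (rule has_sum_cmult_right)
  have le: "norm (exp (- \<delta> * \<bar>t - x l\<bar>)) \<le> exp (\<delta> * q) * ?h (l - m)" for l
    using mult_left_mono[OF quasi_uniform_dist_bracket[OF qu q m, of l], of \<delta>] \<delta>
    by (simp add: algebra_simps flip: exp_add)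
  show "(\<lambda>l. exp (- \<delta> * \<bar>t - x l\<bar>)) summable_on UNIV"
    by (rule dominated_summable_on[OF sum le])
  show "(\<Sum>\<^sub>\<infinity>l. exp (- \<delta> * \<bar>t - x l\<bar>)) \<le> exp (\<delta> * q) * infsum ?h UNIV"
    using norm_infsum_dominated_le[OF sum le] by simp
qed

lemma norm_gauss_le:
  assumes "0 < lam" "0 < q"
  shows "norm (gauss lam s) \<le> exp (1 / (4 * lam * q\<^sup>2)) * exp (- (1 / q) * \<bar>s\<bar>)"
  using gaussian_le_exp_abs[OF assms, of s] by (simp add: gauss_def)

lemma exp_abs_int_has_sum:
  assumes "0 < r"
  shows "((\<lambda>k. exp (- r * \<bar>real_of_int (k - j)\<bar>)) has_sum (\<Sum>\<^sub>\<infinity>n::int. exp (- r * \<bar>real_of_int n\<bar>))) UNIV"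
  using has_sum_infsum[OF summable_on_int_shift[OF exp_abs_summable_on_int[OF assms], of j]]
  unfolding infsum_int_shift[OF exp_abs_summable_on_int[OF assms]] .

text \<open>The upper bound \<open>Q\<close> on the gaps enters through \<open>\<bar>t - x l\<bar>
  \<le> \<bar>t - x k\<bar> + Q * \<bar>k - l\<bar>\<close>, which converts decay in the index into
  decay in space. Half of the index decay is spent on this, the other half sums over
  \<open>k\<close>.\<close>

lemma gauss_fundamental_decay:
  assumes pos: "0 < lam" "0 < q" "0 < Q"
  obtains \<delta> K where "0 < \<delta>" "0 < K"
    "\<And>x l t. quasi_uniform q Q x \<Longrightarrow> norm (gauss_fundamental lam x l t) \<le> K * exp (- \<delta> * \<bar>t - x l\<bar>)"
proof (rule gauss_inv_decay[OF pos(1,2)])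
  fix \<epsilon> K0 :: real
  assume \<epsilon>: "0 < \<epsilon>" and K0: "0 < K0" and decay:
    "\<And>x k l. (\<And>j k. q * \<bar>real_of_int (j - k)\<bar> \<le> \<bar>x j - x k\<bar>) \<Longrightarrow>
      norm (gauss_inv lam x k l) \<le> K0 * exp (- \<epsilon> * \<bar>real_of_int (k - l)\<bar>)"
  \<comment> \<open>The first entry respects the rate of the Gaussian factor; the second gives
    \<open>\<delta> * Q \<le> \<epsilon> / 2\<close>, the half of the index decay that may be
    spent.\<close>
  define \<delta> where "\<delta> = min (1 / q) (\<epsilon> / (2 * Q))"
  have \<delta>: "0 < \<delta>" "\<delta> \<le> 1 / q" "\<delta> * Q \<le> \<epsilon> / 2"
  proof -
    show "0 < \<delta>" "\<delta> \<le> 1 / q" using \<epsilon> pos by (auto simp: \<delta>_def)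
    have "\<delta> * Q \<le> \<epsilon> / (2 * Q) * Q" using pos by (intro mult_right_mono) (auto simp: \<delta>_def)
    then show "\<delta> * Q \<le> \<epsilon> / 2" using pos by simp
  qed
  define C where "C = exp (1 / (4 * lam * q\<^sup>2))"
  define S where "S = (\<Sum>\<^sub>\<infinity>n::int. exp (- (\<epsilon> / 2) * \<bar>real_of_int n\<bar>))"
  have S: "0 < S"
  proof -
    have "exp (- (\<epsilon> / 2) * \<bar>real_of_int 0\<bar>) \<le> S"
      unfolding S_def
      using finite_sum_le_infsum[OF exp_abs_summable_on_int[of "\<epsilon> / 2"], of "{0}"] \<epsilon> by simp
    then show ?thesis by simp
  qed
  show thesis
  proof (rule that[OF \<delta>(1), of "K0 * C * S"])
    show "0 < K0 * C * S" using K0 S by (simp add: C_def)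
    fix x l t assume qu: "quasi_uniform q Q x"
    have sum: "((\<lambda>k. (K0 * C * exp (- \<delta> * \<bar>t - x l\<bar>)) * exp (- (\<epsilon> / 2) * \<bar>real_of_int (k - l)\<bar>))
        has_sum (K0 * C * exp (- \<delta> * \<bar>t - x l\<bar>)) * S) UNIV"
      unfolding S_def using \<epsilon> by (intro has_sum_cmult_right exp_abs_int_has_sum) simp
    have le: "norm (gauss_inv lam x k l * gauss lam (t - x k))
        \<le> (K0 * C * exp (- \<delta> * \<bar>t - x l\<bar>)) * exp (- (\<epsilon> / 2) * \<bar>real_of_int (k - l)\<bar>)" for k
    proof -
      let ?m = "\<bar>real_of_int (k - l)\<bar>"
      have "norm (gauss_inv lam x k l * gauss lam (t - x k))
          \<le> (K0 * exp (- \<epsilon> * ?m)) * (C * exp (- (1 / q) * \<bar>t - x k\<bar>))"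
        unfolding norm_mult C_def
        using K0 by (intro mult_mono decay norm_gauss_le quasi_uniform_dist[OF qu] pos) auto
      also have "\<dots> = K0 * C * exp (- \<epsilon> * ?m - 1 / q * \<bar>t - x k\<bar>)"
        by (simp add: exp_diff exp_minus field_simps)
      also have "\<dots> \<le> K0 * C * exp (- \<delta> * \<bar>t - x l\<bar> - \<epsilon> / 2 * ?m)"
      proof -
        have "\<bar>t - x l\<bar> \<le> \<bar>t - x k\<bar> + Q * ?m"
          using quasi_uniform_dist(2)[OF qu pos(2), of k l] by linarith
        then have "\<delta> * \<bar>t - x l\<bar> \<le> \<delta> * (\<bar>t - x k\<bar> + Q * ?m)"
          using \<delta>(1) by (intro mult_left_mono) auto
        also have "\<dots> = \<delta> * \<bar>t - x k\<bar> + \<delta> * Q * ?m" by (simp add: distrib_left)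
        also have "\<dots> \<le> 1 / q * \<bar>t - x k\<bar> + \<epsilon> / 2 * ?m"
          using \<delta> by (intro add_mono mult_right_mono) auto
        finally have "- \<epsilon> * ?m - 1 / q * \<bar>t - x k\<bar> \<le> - \<delta> * \<bar>t - x l\<bar> - \<epsilon> / 2 * ?m"
          by (simp add: field_simps)
        then show ?thesis using K0 by (intro mult_left_mono) (auto simp: C_def)
      qed
      also have "\<dots> = (K0 * C * exp (- \<delta> * \<bar>t - x l\<bar>)) * exp (- (\<epsilon> / 2) * ?m)"
        by (simp add: mult.assoc flip: exp_add)
      finally show ?thesis .
    qed
    show "norm (gauss_fundamental lam x l t) \<le> K0 * C * S * exp (- \<delta> * \<bar>t - x l\<bar>)"
      unfolding gauss_fundamental_def using norm_infsum_dominated_le[OF sum le] by (simp only: mult_ac)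
  qed
qed

text \<open>For bounded \<open>y\<close> the double series over \<open>(k, l)\<close> converges
  absolutely. Summing over \<open>l\<close> first gives the interpolant, summing over
  \<open>k\<close> first gives the series in the fundamental functions.\<close>

lemma
  assumes pos: "0 < lam" "0 < q" and qu: "quasi_uniform q Q x" and Y: "\<And>l. norm (y l) \<le> Y"
  shows gauss_interp_has_sum:
      "((\<lambda>l. y l * gauss_fundamental lam x l t) has_sum gauss_interp lam x y t) UNIV"
    and continuous_gauss_interp: "continuous_on UNIV (gauss_interp lam x y)"
proof -
  obtain \<epsilon> K where \<epsilon>: "0 < \<epsilon>" and K: "0 < K" and decay:
    "norm (gauss_inv lam x k l) \<le> K * exp (- \<epsilon> * \<bar>real_of_int (k - l)\<bar>)" for k l
    using gauss_inv_decay[OF pos] quasi_uniform_dist(1)[OF qu pos(2)] by metis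
  have Y0: "0 \<le> Y" using Y[of 0] norm_ge_zero order_trans by blast
  define C where "C = exp (1 / (4 * lam * q\<^sup>2))"
  define S where "S = (\<Sum>\<^sub>\<infinity>n::int. exp (- \<epsilon> * \<bar>real_of_int n\<bar>))"
  have gauss_le: "norm (gauss lam s) \<le> C * exp (- (1 / q) * \<bar>s\<bar>)" for s
    unfolding C_def by (rule norm_gauss_le[OF pos])
  have row: "((\<lambda>l. K * exp (- \<epsilon> * \<bar>real_of_int (k - l)\<bar>) * Y) has_sum K * S * Y) UNIV" for k
    using has_sum_cmult_left[OF has_sum_cmult_right[OF exp_abs_int_has_sum[OF \<epsilon>, of k], of K], of Y]
    by (simp add: S_def abs_minus_commute)
  have row_le: "norm (gauss_inv lam x k l * y l) \<le> K * exp (- \<epsilon> * \<bar>real_of_int (k - l)\<bar>) * Y" for k l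
    unfolding norm_mult using K Y Y0 by (intro mult_mono decay) auto
  have coeff_le: "norm (matrix_apply (gauss_inv lam x) y k) \<le> K * S * Y" for k
    unfolding matrix_apply_def by (rule norm_infsum_dominated_le[OF row row_le])
  have gauss_sum: "(\<lambda>k. C * exp (- (1 / q) * \<bar>t - x k\<bar>)) summable_on UNIV" for t
    using pos by (intro summable_on_cmult_right exp_dist_summable[OF qu pos(2)]) simp

  define F where "F = (\<lambda>(k, l). (gauss_inv lam x k l * y l) * gauss lam (t - x k))"
  \<comment> \<open>This majorant separates into decay in \<open>k - l\<close> and decay in
    \<open>t - x k\<close>: the sum over \<open>l\<close> has a value independent of
    \<open>k\<close>, and the remaining sum over \<open>k\<close> is an exponential sum over the
    nodes.\<close>
  define H where "H = (\<lambda>(k, l). (K * exp (- \<epsilon> * \<bar>real_of_int (k - l)\<bar>) * Y) * (C * exp (- (1 / q) * \<bar>t - x k\<bar>)))"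
  have "H summable_on UNIV \<times> UNIV"
  proof (rule summable_on_SigmaI)
    show "((\<lambda>l. H (k, l)) has_sum (K * S * Y) * (C * exp (- (1 / q) * \<bar>t - x k\<bar>))) UNIV" for k
      unfolding H_def case_prod_conv by (rule has_sum_cmult_left[OF row])
    show "(\<lambda>k. (K * S * Y) * (C * exp (- (1 / q) * \<bar>t - x k\<bar>))) summable_on UNIV"
      by (rule summable_on_cmult_right[OF gauss_sum])
    show "0 \<le> H (k, l)" for k l
      using K Y0 by (simp add: H_def C_def)
  qed
  then have F_sum: "F summable_on UNIV \<times> UNIV"
  proof (rule dominated_summable_on[OF has_sum_infsum])
    show "norm (F z) \<le> H z" for z
      unfolding F_def H_def using row_le gauss_le K Y0
      by (cases z) (simp only: case_prod_conv norm_mult[of "_ * _" "gauss _ _"], intro mult_mono, auto)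
  qed
  define A where "A = infsum F (UNIV \<times> UNIV)"
  have F_A: "(F has_sum A) (UNIV \<times> UNIV)"
    unfolding A_def using F_sum by (rule has_sum_infsum)
  have "((\<lambda>k. matrix_apply (gauss_inv lam x) y k * gauss lam (t - x k)) has_sum A) UNIV"
  proof (rule has_sum_SigmaD[OF F_A])
    show "((\<lambda>l. F (k, l)) has_sum matrix_apply (gauss_inv lam x) y k * gauss lam (t - x k)) UNIV" for k
      unfolding F_def case_prod_conv matrix_apply_def
      by (intro has_sum_cmult_left has_sum_infsum dominated_summable_on[OF row row_le])
  qed
  then have interp: "gauss_interp lam x y t = A"
    unfolding gauss_interp_def by (rule infsumI)
  have "((\<lambda>(l, k). F (k, l)) has_sum A) (UNIV \<times> UNIV)"
    using F_A by (subst has_sum_reindex_bij_witness[where i = prod.swap and j = prod.swap and T = "UNIV \<times> UNIV" and h = F]) auto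
  then show "((\<lambda>l. y l * gauss_fundamental lam x l t) has_sum gauss_interp lam x y t) UNIV"
    unfolding interp
  proof (rule has_sum_SigmaD)
    fix l
    have "(\<lambda>k. gauss_inv lam x k l * gauss lam (t - x k)) summable_on UNIV"
    proof (rule dominated_summable_on)
      show "((\<lambda>k. K * (C * exp (- (1 / q) * \<bar>t - x k\<bar>))) has_sum (\<Sum>\<^sub>\<infinity>k. K * (C * exp (- (1 / q) * \<bar>t - x k\<bar>)))) UNIV"
        by (intro has_sum_infsum summable_on_cmult_right[OF gauss_sum])
      fix k
      have "norm (gauss_inv lam x k l) \<le> K * exp (- \<epsilon> * \<bar>real_of_int (k - l)\<bar>)" by (rule decay)
      also have "\<dots> \<le> K" using K \<epsilon> by simp
      finally show "norm (gauss_inv lam x k l * gauss lam (t - x k)) \<le> K * (C * exp (- (1 / q) * \<bar>t - x k\<bar>))"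
        unfolding norm_mult using K gauss_le by (intro mult_mono) auto
    qed
    then have "((\<lambda>k. y l * (gauss_inv lam x k l * gauss lam (t - x k))) has_sum y l * gauss_fundamental lam x l t) UNIV"
      unfolding gauss_fundamental_def by (intro has_sum_cmult_right has_sum_infsum)
    then show "((\<lambda>k. case (l, k) of (l, k) \<Rightarrow> F (k, l)) has_sum y l * gauss_fundamental lam x l t) UNIV"
      by (simp add: F_def mult_ac)
  qed

  \<comment> \<open>On a bounded set \<open>\<bar>t - x k\<bar> \<ge> \<bar>x k\<bar> - T\<close>,
    so the terms have a summable majorant independent of \<open>t\<close> and the Weierstrass test
    applies.\<close>
  have "continuous_on (ball 0 T) (gauss_interp lam x y)" for T
  proof (rule uniform_limit_theorem)
    show "uniform_limit (ball 0 T)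
        (\<lambda>X t. \<Sum>k\<in>X. matrix_apply (gauss_inv lam x) y k * gauss lam (t - x k))
        (gauss_interp lam x y) (finite_subsets_at_top UNIV)"
      unfolding gauss_interp_def
    proof (rule Weierstrass_m_test_general)
      show "(\<lambda>k. (K * S * Y * exp (1 / q * T)) * (C * exp (- (1 / q) * \<bar>0 - x k\<bar>))) summable_on UNIV"
        by (rule summable_on_cmult_right[OF gauss_sum])
      fix k t assume "t \<in> ball (0::real) T"
      then have t: "\<bar>t\<bar> < T" by simp
      have "norm (gauss lam (t - x k)) \<le> C * exp (- (1 / q) * \<bar>t - x k\<bar>)" by (rule gauss_le)
      also have "\<dots> \<le> C * exp (1 / q * T - 1 / q * \<bar>0 - x k\<bar>)"
      proof -
        have "1 / q * (\<bar>0 - x k\<bar> - T) \<le> 1 / q * \<bar>t - x k\<bar>"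
          using t pos by (intro mult_left_mono) auto
        then show ?thesis
          unfolding C_def right_diff_distrib by (intro mult_left_mono) simp_all
      qed
      also have "\<dots> = exp (1 / q * T) * (C * exp (- (1 / q) * \<bar>0 - x k\<bar>))"
        by (simp add: exp_diff exp_minus field_simps)
      finally show "norm (matrix_apply (gauss_inv lam x) y k * gauss lam (t - x k))
          \<le> (K * S * Y * exp (1 / q * T)) * (C * exp (- (1 / q) * \<bar>0 - x k\<bar>))"
        unfolding norm_mult mult.assoc[of "K * S * Y"]
        using coeff_le[of k] order_trans[OF norm_ge_zero coeff_le[of k]] by (intro mult_mono) auto
    qed
    show "\<forall>\<^sub>F X in finite_subsets_at_top UNIV.
        continuous_on (ball 0 T) (\<lambda>t. \<Sum>k\<in>X. matrix_apply (gauss_inv lam x) y k * gauss lam (t - x k))"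
      unfolding gauss_def by (intro always_eventually allI continuous_intros)
  qed simp
  then have "continuous_on (\<Union>T::real. ball 0 T) (gauss_interp lam x y)"
    by (intro continuous_on_open_UN) auto
  also have "(\<Union>T::real. ball 0 T) = (UNIV :: real set)"
    by (auto intro: gt_ex)
  finally show "continuous_on UNIV (gauss_interp lam x y)" .
qed

subsection \<open>Bounds in \<open>L\<^sub>p\<close>\<close>

text \<open>Young's inequality \<open>a * m powr (r - 1) \<le> a powr r / r + (1 - 1 / r) * m powr r\<close> is applied at the
  weighted mean \<open>m\<close> of the \<open>a l\<close>.\<close>

lemma weighted_powr_sum_le:
  fixes w a :: "'a \<Rightarrow> real"
  assumes "finite F" "\<And>l. 0 \<le> w l" "\<And>l. 0 \<le> a l" "(\<Sum>l\<in>F. w l) \<le> W" "0 < W" "1 \<le> r"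
  shows "(\<Sum>l\<in>F. w l * a l) powr r \<le> W powr (r - 1) * (\<Sum>l\<in>F. w l * a l powr r)"
proof (cases "r = 1")
  case True
  then show ?thesis using assms by (simp add: sum_nonneg)
next
  case False
  with assms have r: "1 < r" by simp
  \<comment> \<open>Normalised by the bound \<open>W\<close> instead of the actual total weight; the
    difference is absorbed when the sum of the weights is estimated by \<open>W\<close>.\<close>
  define m where "m = (\<Sum>l\<in>F. w l * a l) / W"
  have m: "0 \<le> m" using assms by (auto simp: m_def intro!: divide_nonneg_nonneg sum_nonneg)
  have young: "a l * m powr (r - 1) \<le> a l powr r / r + (1 - 1 / r) * m powr r" for l
  proof -
    have "a l * m powr (r - 1) \<le> a l powr r / r + (m powr (r - 1)) powr (r / (r - 1)) / (r / (r - 1))"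
      using r assms by (intro Youngs_inequality) (auto simp: field_simps)
    also have "(m powr (r - 1)) powr (r / (r - 1)) = m powr r"
      using r by (simp add: powr_powr)
    also have "m powr r / (r / (r - 1)) = (1 - 1 / r) * m powr r"
      using r by (simp add: field_simps)
    finally show ?thesis .
  qed
  have mm: "m powr r = m * m powr (r - 1)"
    using m r by (cases "m = 0") (simp_all add: powr_mult_base)
  have "W * m powr r = (\<Sum>l\<in>F. w l * a l) * m powr (r - 1)"
    unfolding mm using assms by (simp add: m_def)
  also have "\<dots> = (\<Sum>l\<in>F. w l * (a l * m powr (r - 1)))"
    by (simp add: sum_distrib_right mult.assoc)
  also have "\<dots> \<le> (\<Sum>l\<in>F. w l * (a l powr r / r + (1 - 1 / r) * m powr r))"
    using assms by (intro sum_mono mult_left_mono young)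
  also have "\<dots> = (\<Sum>l\<in>F. w l * a l powr r) / r + (\<Sum>l\<in>F. w l) * ((1 - 1 / r) * m powr r)"
    by (simp add: distrib_left sum.distrib sum_distrib_right sum_divide_distrib)
  also have "\<dots> \<le> (\<Sum>l\<in>F. w l * a l powr r) / r + W * ((1 - 1 / r) * m powr r)"
    using assms r by (intro add_left_mono mult_right_mono) auto
  finally have "W * m powr r \<le> (\<Sum>l\<in>F. w l * a l powr r)"
    using r by (simp add: field_simps)
  then have "W powr (r - 1) * (W * m powr r) \<le> W powr (r - 1) * (\<Sum>l\<in>F. w l * a l powr r)"
    by (intro mult_left_mono) auto
  also have "W powr (r - 1) * (W * m powr r) = (W powr (r - 1) * W) * m powr r"
    by (simp only: mult.assoc)
  also have "W powr (r - 1) * W = W powr r"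
    using assms by (simp add: powr_diff)
  also have "W powr r * m powr r = (W * m) powr r"
    using assms m by (simp add: powr_mult)
  also have "W * m = (\<Sum>l\<in>F. w l * a l)"
    using assms by (simp add: m_def)
  finally show ?thesis .
qed

lemma nn_integral_exp_abs:
  assumes "0 < \<delta>"
  shows "(\<integral>\<^sup>+t. ennreal (exp (- \<delta> * \<bar>t - a\<bar>)) \<partial>lborel) \<le> ennreal (2 / \<delta>)"
proof -
  let ?g = "\<lambda>t::real. ennreal (exp (- \<delta> * t)) * indicator {0..} t"
  have lim: "((\<lambda>t. - exp (- \<delta> * t) / \<delta>) \<longlongrightarrow> - 0 / \<delta>) at_top"
  proof (intro tendsto_intros)
    have "LIM t at_top. - \<delta> * t :> at_bot"
      using assms by (intro filterlim_tendsto_neg_mult_at_bot[OF tendsto_const _ filterlim_ident]) auto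
    then show "((\<lambda>t. exp (- \<delta> * t)) \<longlongrightarrow> 0) at_top"
      by (rule filterlim_compose[OF exp_at_bot])
  qed (use assms in auto)
  have half: "(\<integral>\<^sup>+t. ?g t \<partial>lborel) = ennreal (1 / \<delta>)"
    by (subst nn_integral_FTC_atLeast[OF _ _ _ lim])
      (use assms in \<open>auto intro!: derivative_eq_intros\<close>)
  have "(\<integral>\<^sup>+t. ennreal (exp (- \<delta> * \<bar>t - a\<bar>)) \<partial>lborel) = (\<integral>\<^sup>+t. ennreal (exp (- \<delta> * \<bar>t\<bar>)) \<partial>lborel)"
    by (subst nn_integral_real_affine[where c = 1 and t = a]) auto
  \<comment> \<open>Both half-lines contain 0, so the pointwise relation is an inequality.\<close>
  also have "\<dots> \<le> (\<integral>\<^sup>+t. ?g t + ?g (0 + (- 1) * t) \<partial>lborel)"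
    by (intro nn_integral_mono) (auto split: split_indicator)
  also have "\<dots> = (\<integral>\<^sup>+t. ?g t \<partial>lborel) + (\<integral>\<^sup>+t. ?g (0 + (- 1) * t) \<partial>lborel)"
    by (intro nn_integral_add) measurable
  also have "(\<integral>\<^sup>+t. ?g (0 + (- 1) * t) \<partial>lborel) = (\<integral>\<^sup>+t. ?g t \<partial>lborel)"
    by (subst (2) nn_integral_real_affine[where c = "- 1" and t = 0]) auto
  also have "(\<integral>\<^sup>+t. ?g t \<partial>lborel) + (\<integral>\<^sup>+t. ?g t \<partial>lborel) = ennreal (2 / \<delta>)"
    unfolding half using assms by (simp flip: ennreal_plus)
  finally show ?thesis .
qed

text \<open>Expresses sums over the index set as integrals for the counting measure, so that
  Tonelli's theorem can exchange them with integrals over the line.\<close>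

lemma nn_integral_count_space_infsum:
  fixes h :: "'a \<Rightarrow> real"
  assumes "h summable_on A" "\<And>x. x \<in> A \<Longrightarrow> 0 \<le> h x"
  shows "(\<integral>\<^sup>+x. ennreal (h x) \<partial>count_space A) = ennreal (infsum h A)"
proof -
  have "Infinite_Set_Sum.abs_summable_on h A"
    using assms(1) unfolding abs_summable_equivalent[symmetric]
    by (rule iffD1[OF summable_on_iff_abs_summable_on_real])
  then show ?thesis
    using nn_integral_conv_infsetsum[of h A] assms(2) by (simp add: infsetsum_infsum)
qed

text \<open>Schur's test between sequences and functions. The weights
  \<open>K * exp (- \<delta> * \<bar>t - x l\<bar>)\<close> have sum over \<open>l\<close> at most
  \<open>K * B\<close> and integral over \<open>t\<close> at most \<open>2 * K / \<delta>\<close>.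
  The first bound enters pointwise with exponent \<open>r - 1\<close>, the second after Tonelli.
  Nonnegative integrals are used because integrability is itself a conclusion.\<close>

lemma Lp_bound_of_exp_decay:
  fixes g :: "real \<Rightarrow> complex" and L :: "int \<Rightarrow> real \<Rightarrow> complex" and y :: "int \<Rightarrow> complex"
  assumes g: "\<And>t. ((\<lambda>l. y l * L l t) has_sum g t) UNIV" "g \<in> borel_measurable lborel"
    and L: "\<And>l t. norm (L l t) \<le> K * exp (- \<delta> * \<bar>t - x l\<bar>)"
    and B: "\<And>t F. finite F \<Longrightarrow> (\<Sum>l\<in>F. exp (- \<delta> * \<bar>t - x l\<bar>)) \<le> B"
    and pos: "0 < K" "0 < \<delta>" "0 < B" "1 \<le> r"
    and y: "(\<lambda>l. norm (y l) powr r) summable_on UNIV"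
  shows "integrable lborel (\<lambda>t. norm (g t) powr r)"
    and "(LINT t|lborel. norm (g t) powr r)
      \<le> (K * B) powr (r - 1) * K * (2 / \<delta>) * (\<Sum>\<^sub>\<infinity>l. norm (y l) powr r)"
proof -
  define c where "c = (K * B) powr (r - 1) * K"
  have c: "0 \<le> c" using pos by (simp add: c_def)
  define N where "N = (\<Sum>\<^sub>\<infinity>l. norm (y l) powr r)"
  have N: "0 \<le> N" unfolding N_def by (intro infsum_nonneg) auto
  let ?h = "\<lambda>t l. ennreal (c * norm (y l) powr r * exp (- \<delta> * \<bar>t - x l\<bar>))"
  have fin: "norm (\<Sum>l\<in>F. y l * L l t) powr r \<le> (\<Sum>l\<in>F. c * norm (y l) powr r * exp (- \<delta> * \<bar>t - x l\<bar>))"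
    if "finite F" for F t
  proof -
    have "norm (\<Sum>l\<in>F. y l * L l t) \<le> (\<Sum>l\<in>F. norm (y l * L l t))" by (rule norm_sum)
    also have "\<dots> \<le> (\<Sum>l\<in>F. (K * exp (- \<delta> * \<bar>t - x l\<bar>)) * norm (y l))"
      unfolding norm_mult by (intro sum_mono) (metis L mult.commute mult_left_mono norm_ge_zero)
    finally have "norm (\<Sum>l\<in>F. y l * L l t) powr r \<le> (\<Sum>l\<in>F. (K * exp (- \<delta> * \<bar>t - x l\<bar>)) * norm (y l)) powr r"
      using pos by (intro powr_mono2) auto
    also have "\<dots> \<le> (K * B) powr (r - 1) * (\<Sum>l\<in>F. (K * exp (- \<delta> * \<bar>t - x l\<bar>)) * norm (y l) powr r)"
      using that pos B[OF that, of t] by (intro weighted_powr_sum_le) (auto simp flip: sum_distrib_left)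
    also have "\<dots> = (\<Sum>l\<in>F. c * norm (y l) powr r * exp (- \<delta> * \<bar>t - x l\<bar>))"
      by (simp add: c_def sum_distrib_left mult_ac)
    finally show ?thesis .
  qed
  have pw: "ennreal (norm (g t) powr r) \<le> (\<integral>\<^sup>+l. ?h t l \<partial>count_space UNIV)" for t
  proof (rule tendsto_upperbound)
    show "((\<lambda>F. ennreal (norm (\<Sum>l\<in>F. y l * L l t) powr r)) \<longlongrightarrow> ennreal (norm (g t) powr r)) (finite_subsets_at_top UNIV)"
      using g(1)[of t] pos unfolding has_sum_def
      by (intro tendsto_ennrealI tendsto_powr' tendsto_norm tendsto_const) auto
    show "\<forall>\<^sub>F F in finite_subsets_at_top UNIV.
        ennreal (norm (\<Sum>l\<in>F. y l * L l t) powr r) \<le> (\<integral>\<^sup>+l. ?h t l \<partial>count_space UNIV)"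
    proof (rule eventually_finite_subsets_at_top_weakI)
      fix F :: "int set" assume F: "finite F"
      have "ennreal (norm (\<Sum>l\<in>F. y l * L l t) powr r) \<le> (\<Sum>l\<in>F. ?h t l)"
        using fin[OF F, of t] c by (simp add: sum_ennreal ennreal_leI)
      also have "\<dots> = (\<integral>\<^sup>+l. ?h t l \<partial>count_space F)"
        using F by (simp add: nn_integral_count_space_finite)
      also have "\<dots> = (\<integral>\<^sup>+l. ?h t l * indicator F l \<partial>count_space UNIV)"
        by (simp add: nn_integral_count_space_indicator)
      also have "\<dots> \<le> (\<integral>\<^sup>+l. ?h t l \<partial>count_space UNIV)"
        by (intro nn_integral_mono) (auto split: split_indicator)
      finally show "ennreal (norm (\<Sum>l\<in>F. y l * L l t) powr r) \<le> (\<integral>\<^sup>+l. ?h t l \<partial>count_space UNIV)" .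
    qed
  qed simp
  have "(\<integral>\<^sup>+t. ennreal (norm (g t) powr r) \<partial>lborel) \<le> (\<integral>\<^sup>+t. \<integral>\<^sup>+l. ?h t l \<partial>count_space UNIV \<partial>lborel)"
    by (intro nn_integral_mono pw)
  also have "\<dots> = (\<integral>\<^sup>+l. \<integral>\<^sup>+t. ?h t l \<partial>lborel \<partial>count_space UNIV)"
    by (rule nn_integral_count_space_nn_integral) auto
  also have "\<dots> \<le> (\<integral>\<^sup>+l. ennreal (c * (2 / \<delta>) * norm (y l) powr r) \<partial>count_space UNIV)"
  proof (rule nn_integral_mono)
    fix l
    have "(\<integral>\<^sup>+t. ?h t l \<partial>lborel) = ennreal (c * norm (y l) powr r) * (\<integral>\<^sup>+t. ennreal (exp (- \<delta> * \<bar>t - x l\<bar>)) \<partial>lborel)"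
      using c by (subst nn_integral_cmult[symmetric]) (auto simp: ennreal_mult intro!: nn_integral_cong)
    also have "\<dots> \<le> ennreal (c * norm (y l) powr r) * ennreal (2 / \<delta>)"
      by (intro mult_left_mono nn_integral_exp_abs pos) simp
    also have "\<dots> = ennreal (c * (2 / \<delta>) * norm (y l) powr r)"
      using c pos by (simp add: mult_ac flip: ennreal_mult)
    finally show "(\<integral>\<^sup>+t. ?h t l \<partial>lborel) \<le> ennreal (c * (2 / \<delta>) * norm (y l) powr r)" .
  qed
  also have "\<dots> = ennreal (\<Sum>\<^sub>\<infinity>l. c * (2 / \<delta>) * norm (y l) powr r)"
    using c pos by (intro nn_integral_count_space_infsum summable_on_cmult_right y) auto
  also have "(\<Sum>\<^sub>\<infinity>l. c * (2 / \<delta>) * norm (y l) powr r) = c * (2 / \<delta>) * N"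
    unfolding N_def by (rule infsum_cmult_right')
  finally have nn: "(\<integral>\<^sup>+t. ennreal (norm (g t) powr r) \<partial>lborel) \<le> ennreal (c * (2 / \<delta>) * N)" .
  have meas: "(\<lambda>t. norm (g t) powr r) \<in> borel_measurable lborel"
    using g(2) by measurable
  show int: "integrable lborel (\<lambda>t. norm (g t) powr r)"
    using nn by (intro integrableI_nonneg meas) (auto simp: le_less_trans)
  have "ennreal (LINT t|lborel. norm (g t) powr r) \<le> ennreal (c * (2 / \<delta>) * N)"
    using nn nn_integral_eq_integral[OF int] by simp
  then show "(LINT t|lborel. norm (g t) powr r) \<le> (K * B) powr (r - 1) * K * (2 / \<delta>) * (\<Sum>\<^sub>\<infinity>l. norm (y l) powr r)"
    using c N pos by (simp add: c_def N_def)
qed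

text \<open>Reduces continuity and the series expansion to bounded data, for all exponents at
  once.\<close>

lemma ell_space_bounded:
  assumes "y \<in> ell_space p" "1 \<le> p"
  obtains Y where "\<And>l. norm (y l) \<le> Y"
proof (cases "p = \<infinity>")
  case True
  then show ?thesis using assms that by (auto simp: ell_space_def bounded_iff)
next
  case False
  define r where "r = real_of_ereal p"
  have r: "1 \<le> r" using assms(2) False by (cases p) (auto simp: r_def one_ereal_def)
  have sum: "(\<lambda>l. norm (y l) powr r) summable_on UNIV"
    using assms(1) False by (simp add: ell_space_def r_def)
  have "norm (y l) \<le> (\<Sum>\<^sub>\<infinity>l. norm (y l) powr r) powr (1 / r)" for l
  proof -
    have "norm (y l) powr r \<le> (\<Sum>\<^sub>\<infinity>l. norm (y l) powr r)"
      using finite_sum_le_infsum[OF sum, of "{l}"] by simp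
    then have "(norm (y l) powr r) powr (1 / r) \<le> (\<Sum>\<^sub>\<infinity>l. norm (y l) powr r) powr (1 / r)"
      using r by (intro powr_mono2) auto
    then show ?thesis using r by (simp add: powr_powr)
  qed
  then show ?thesis by (rule that)
qed

text \<open>The numbers \<open>\<delta>\<close>, \<open>K\<close> and \<open>B\<close> are fixed
  before the nodes. The constant is \<open>K * B\<close> for \<open>p = \<infinity>\<close>, and
  otherwise the \<open>r\<close>-th root of the constant in the integral estimate.\<close>

lemma gauss_interp_Lp_bound:
  assumes pos: "0 < lam" "0 < q" "0 < Q" and p: "1 \<le> p"
  shows "\<exists>\<beta>. \<forall>x. quasi_uniform q Q x \<longrightarrow> (\<forall>y \<in> ell_space p.
    gauss_interp lam x y \<in> Lp_space p \<and> Lp_norm p (gauss_interp lam x y) \<le> \<beta> * ell_norm p y)"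
proof (rule gauss_fundamental_decay[OF pos])
  fix \<delta> K :: real
  assume \<delta>: "0 < \<delta>" and K: "0 < K" and decay: "\<And>x l t. quasi_uniform q Q x \<Longrightarrow>
      norm (gauss_fundamental lam x l t) \<le> K * exp (- \<delta> * \<bar>t - x l\<bar>)"
  define B where "B = exp (\<delta> * q) * (\<Sum>\<^sub>\<infinity>n::int. exp (- (\<delta> * q) * \<bar>real_of_int n\<bar>))"
  have B_le: "(\<Sum>l\<in>F. exp (- \<delta> * \<bar>t - x l\<bar>)) \<le> B" if "quasi_uniform q Q x" "finite F" for x t F
    using finite_sum_le_infsum[OF exp_dist_summable[OF that(1) pos(2) \<delta>, of t] that(2)]
      infsum_exp_dist_le[OF that(1) pos(2) \<delta>, of t] by (simp add: B_def)
  have B: "0 < B"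
  proof -
    have "0 < exp (- (\<delta> * q) * \<bar>real_of_int 0\<bar>)" by simp
    also have "\<dots> \<le> (\<Sum>\<^sub>\<infinity>n::int. exp (- (\<delta> * q) * \<bar>real_of_int n\<bar>))"
      using finite_sum_le_infsum[OF exp_abs_summable_on_int[of "\<delta> * q"], of "{0}"] \<delta> pos by simp
    finally show ?thesis by (simp add: B_def)
  qed
  show ?thesis
  proof (cases "p = \<infinity>")
    case True
    show ?thesis
    proof (intro exI[of _ "K * B"] allI impI ballI)
      fix x y assume qu: "quasi_uniform q Q x" and y: "y \<in> ell_space p"
      let ?g = "gauss_interp lam x y"
      let ?Y = "SUP l. norm (y l)"
      have bdd: "bdd_above (range (\<lambda>l. norm (y l)))"
        using y True by (auto simp: ell_space_def bounded_iff bdd_above_def)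
      have Y: "norm (y l) \<le> ?Y" for l
        by (rule cSUP_upper[OF UNIV_I bdd])
      note sum = gauss_interp_has_sum[where y = y, OF pos(1,2) qu Y]
      have meas: "?g \<in> borel_measurable lborel"
        using continuous_gauss_interp[where y = y, OF pos(1,2) qu Y] by (simp add: borel_measurable_continuous_onI)
      have "norm (?g t) \<le> K * B * ?Y" for t
      proof (rule tendsto_upperbound)
        show "((\<lambda>F. norm (\<Sum>l\<in>F. y l * gauss_fundamental lam x l t)) \<longlongrightarrow> norm (?g t)) (finite_subsets_at_top UNIV)"
          using sum[of t] unfolding has_sum_def by (rule tendsto_norm)
        show "\<forall>\<^sub>F F in finite_subsets_at_top UNIV. norm (\<Sum>l\<in>F. y l * gauss_fundamental lam x l t) \<le> K * B * ?Y"
        proof (rule eventually_finite_subsets_at_top_weakI)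
          fix F :: "int set" assume F: "finite F"
          have Y0: "0 \<le> ?Y" using order_trans[OF norm_ge_zero Y[of 0]] .
          have "norm (\<Sum>l\<in>F. y l * gauss_fundamental lam x l t) \<le> (\<Sum>l\<in>F. ?Y * (K * exp (- \<delta> * \<bar>t - x l\<bar>)))"
            using Y0 by (intro order_trans[OF norm_sum] sum_mono) (simp only: norm_mult, intro mult_mono Y decay qu, auto)
          also have "\<dots> = ?Y * (K * (\<Sum>l\<in>F. exp (- \<delta> * \<bar>t - x l\<bar>)))"
            by (simp only: sum_distrib_left)
          also have "\<dots> \<le> ?Y * (K * B)"
            using Y0 K by (intro mult_left_mono B_le qu F) auto
          finally show "norm (\<Sum>l\<in>F. y l * gauss_fundamental lam x l t) \<le> K * B * ?Y"
            by (simp only: mult_ac)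
        qed
      qed simp
      then have ess: "esssup lborel (\<lambda>t. ereal (norm (?g t))) \<le> ereal (K * B * ?Y)"
        using meas by (intro esssup_I) auto
      \<comment> \<open>Besides the finite case there is minus infinity, whose real value is the
        default 0; nonnegativity of the bound settles it.\<close>
      then have "real_of_ereal (esssup lborel (\<lambda>t. ereal (norm (?g t)))) \<le> K * B * ?Y"
        using B K order_trans[OF norm_ge_zero Y[of 0]]
        by (cases "esssup lborel (\<lambda>t. ereal (norm (?g t)))") auto
      moreover have "esssup lborel (\<lambda>t. ereal (norm (?g t))) < \<infinity>"
        using ess by (rule le_less_trans) simp
      ultimately show "?g \<in> Lp_space p \<and> Lp_norm p ?g \<le> K * B * ell_norm p y"
        using True meas by (simp add: Lp_space_def Lp_norm_def ell_norm_def)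
    qed
  next
    case False
    define r where "r = real_of_ereal p"
    have r: "1 \<le> r" using p False by (cases p) (auto simp: r_def one_ereal_def)
    let ?c = "(K * B) powr (r - 1) * K * (2 / \<delta>)"
    show ?thesis
    proof (intro exI[of _ "?c powr (1 / r)"] allI impI ballI)
      fix x y assume qu: "quasi_uniform q Q x" and y: "y \<in> ell_space p"
      let ?g = "gauss_interp lam x y"
      obtain Y where Y: "\<And>l. norm (y l) \<le> Y"
        using ell_space_bounded[OF y p] by blast
      have meas: "?g \<in> borel_measurable lborel"
        using continuous_gauss_interp[where y = y, OF pos(1,2) qu Y] by (simp add: borel_measurable_continuous_onI)
      have sum: "(\<lambda>l. norm (y l) powr r) summable_on UNIV"
        using y False by (simp add: ell_space_def r_def)
      note bound = Lp_bound_of_exp_decay[OF gauss_interp_has_sum[where y = y, OF pos(1,2) qu Y] meas decay[OF qu] B_le[OF qu] K \<delta> B r sum]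
      have "(LINT t|lborel. norm (?g t) powr r) powr (1 / r) \<le> (?c * (\<Sum>\<^sub>\<infinity>l. norm (y l) powr r)) powr (1 / r)"
        using r by (intro powr_mono2 bound) (auto intro!: integral_nonneg_AE)
      also have "\<dots> = ?c powr (1 / r) * (\<Sum>\<^sub>\<infinity>l. norm (y l) powr r) powr (1 / r)"
        by (rule powr_mult)
      finally show "?g \<in> Lp_space p \<and> Lp_norm p ?g \<le> ?c powr (1 / r) * ell_norm p y"
        using False meas bound(1) by (simp add: Lp_space_def Lp_norm_def ell_norm_def r_def)
    qed
  qed
qed

theorem theorem6p8:
  fixes lam q Q :: real and p :: ereal
  assumes "lam > 0" and "q > 0" and "Q > 0" and "1 \<le> p"
  shows "(\<forall>x y. quasi_uniform q Q x \<and> y \<in> ell_space p \<longrightarrow>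
            continuous_on UNIV (gauss_interp lam x y) \<and>
            (\<forall>t. ((\<lambda>l. y l * gauss_fundamental lam x l t) has_sum gauss_interp lam x y t) UNIV)) \<and>
         (\<exists>\<beta>\<^sub>3. \<forall>x. quasi_uniform q Q x \<longrightarrow>
            (\<forall>y \<in> ell_space p.
               gauss_interp lam x y \<in> Lp_space p \<and>
               Lp_norm p (gauss_interp lam x y) \<le> \<beta>\<^sub>3 * ell_norm p y))"
proof (intro conjI allI impI)
  fix x y assume "quasi_uniform q Q x \<and> y \<in> ell_space p"
  then have qu: "quasi_uniform q Q x" and y: "y \<in> ell_space p" by auto
  obtain Y where Y: "\<And>l. norm (y l) \<le> Y"
    using ell_space_bounded[OF y assms(4)] by blast
  show "continuous_on UNIV (gauss_interp lam x y)"
    by (rule continuous_gauss_interp[where y = y, OF assms(1,2) qu Y])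
  show "((\<lambda>l. y l * gauss_fundamental lam x l t) has_sum gauss_interp lam x y t) UNIV" for t
    by (rule gauss_interp_has_sum[where y = y, OF assms(1,2) qu Y])
qed (rule gauss_interp_Lp_bound[OF assms])

end
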